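(* Let $f:\mathbb{R}^d\to\mathbb{R}$, $f(x)=\mathbb{E}_{s\sim\mathbb{P}}[\ell(x,s)]$, satisfy the standing assumptions below and attain its minimum at some $x^*$, with all blocks of equal size $d_i=d/h$. Consider $\textsc{Lamb}$ with $\beta_1=0$, $\lambda=0$, $0\le\beta_2<1$, $\epsilon>0$: set $v_0=0$ and for $t=1,\dots,T$, $$g_t=\tfrac1b\textstyle\sum_{s\in\mathcal{S}_t}\nabla\ell(x_t,s),\quad v_t=\beta_2v_{t-1}+(1-\beta_2)g_t^2,\quad \hat v_t=\frac{v_t}{1-\beta_2^t},\quad r_t=\frac{g_t}{\sqrt{\hat v_t}+\epsilon},$$ $$x_{t+1}^{(i)}=x_t^{(i)}-\eta_t\frac{\phi(\|x_t^{(i)}\|)}{\|r_t^{(i)}\|}r_t^{(i)},\quad i\in[h],$$ (squares, square roots and division elementwise; $\beta_2^t$ a power), where $\mathcal{S}_t$ consists of $b$ i.i.d. samples from $\mathbb{P}$ independent of the past. Suppose $\alpha_l\le\phi(v)\le\alpha_u$ for all $v>0$ with $0<\alpha_l\le\alpha_u$, $b=T$, and $\eta_t=\eta=\sqrt{\frac{2(f(x_1)-f(x^* ))}{\alpha_u^2\|L\|_1T}}$ for all $t$. Let $x_a$ be uniform on $\{x_1,\dots,x_T\}$. Then: (1) if $\beta_2=0$, $$\left(\mathbb{E}\left[\tfrac{1}{\sqrt d}\|\nabla f(x_a)\|_1\right]\right)^2\le O\!\left(\frac{(f(x_1)-f(x^* ))L_{avg}}{T}+\frac{\|\tilde\sigma\|_1^2}{Th}\right);$$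 (2) if $\beta_2>0$, $$\mathbb{E}\big[\|\nabla f(x_a)\|^2\big]\le O\!\left(\sqrt{\frac{G^2d}{h(1-\beta_2)}}\left[\sqrt{\frac{2(f(x_1)-f(x^* ))\|L\|_1}{T}}+\frac{\|\tilde\sigma\|_1}{\sqrt T}\right]\right),$$ where the implicit constants depend only on $\alpha_l,\alpha_u$.
   Context: The variable $x\in\mathbb{R}^d$ is partitioned into $h$ blocks (layers): writing the $d\times d$ identity as $[\mathbb{I}_1,\dots,\mathbb{I}_h]$ with $\mathbb{I}_i\in\mathbb{R}^{d\times d_i}$, set $x^{(i)}=\mathbb{I}_i^\top x$; $\nabla_i f$ is the gradient w.r.t. $x^{(i)}$, $r^{(i)}$ the $i$-th block of a vector $r$, and $[v]_j$ the $j$-th coordinate. $\|\cdot\|$ is Euclidean and $\|\cdot\|_1$ the $\ell_1$ norm. Standing assumptions: (i) $\|\nabla_i\ell(x,s)-\nabla_i\ell(y,s)\|\le L_i\|x^{(i)}-y^{(i)}\|$ for all $x,y\in\mathbb{R}^d$, $s\in\mathcal{S}$, $i\in[h]$; $L=(L_1,\dots,L_h)^\top$, $L_{avg}=\frac1h\sum_iL_i$. (ii) Per-coordinate variance: $\mathbb{E}|[\nabla\ell(x,s)]_j-[\nabla f(x)]_j|^2\le\tilde\sigma_j^2$ for all $x$ and $j\in[d]$; $\tilde\sigma=(\tilde\sigma_1,\dots,\tilde\sigma_d)^\top$. (iii) Bounded gradients: $|[\nabla\ell(x,s)]_j|\le G$ for all $j\in[d]$, $x\in\mathbb{R}^d$,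 $s\in\mathcal{S}$.
   Formalization: The bound α_l ≤ φ(v) ≤ α_u is assumed for all v ≥ 0, not only v > 0: if φ(0)=0 and x_1=0 the iterates never move and the claim fails. A block with r_t^{(i)}=0 takes no step, η is 0 if ‖L‖_1=0, and the constant is stated for each fixed type of samples. *)

theory Defs
  imports "HOL-Probability.Probability"
begin

text \<open>Coordinates are indexed by pairs (i,j) with i < h (block/layer) and j < k
  (position inside the block); all blocks have the same size k, so d = h * k.
  Vectors of R^d are functions on nat \<times> nat that vanish outside this index set.\<close>

definition idx :: "nat \<Rightarrow> nat \<Rightarrow> (nat \<times> nat) set" where
  "idx h k = {..<h} \<times> {..<k}"

definition vecs :: "nat \<Rightarrow> nat \<Rightarrow> (nat \<times> nat \<Rightarrow> real) set" where
  "vecs h k = {x. \<forall>c. c \<notin> idx h k \<longrightarrow> x c = 0}"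

definition bnorm :: "nat \<Rightarrow> (nat \<times> nat \<Rightarrow> real) \<Rightarrow> nat \<Rightarrow> real" where
  "bnorm k x i = sqrt (\<Sum>j<k. (x (i, j))^2)"

definition l1norm :: "nat \<Rightarrow> nat \<Rightarrow> (nat \<times> nat \<Rightarrow> real) \<Rightarrow> real" where
  "l1norm h k x = (\<Sum>c\<in>idx h k. \<bar>x c\<bar>)"

definition l2norm :: "nat \<Rightarrow> nat \<Rightarrow> (nat \<times> nat \<Rightarrow> real) \<Rightarrow> real" where
  "l2norm h k x = sqrt (\<Sum>c\<in>idx h k. (x c)^2)"

definition batch_grad ::
  "((nat \<times> nat \<Rightarrow> real) \<Rightarrow> 's \<Rightarrow> nat \<times> nat \<Rightarrow> real) \<Rightarrow> nat \<Rightarrow> (nat \<times> nat \<Rightarrow> 's)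
    \<Rightarrow> nat \<Rightarrow> (nat \<times> nat \<Rightarrow> real) \<Rightarrow> nat \<times> nat \<Rightarrow> real" where
  "batch_grad gl b \<omega> t x c = (\<Sum>m<b. gl x (\<omega> (t, m)) c) / real b"

text \<open>LAMB with beta1 = 0, lambda = 0.  lamb_iter ... n = (x_{n+1}, v_n),
  starting from (x_1, v_0 = 0).\<close>
fun lamb_iter ::
  "nat \<Rightarrow> nat \<Rightarrow> ((nat \<times> nat \<Rightarrow> real) \<Rightarrow> 's \<Rightarrow> nat \<times> nat \<Rightarrow> real) \<Rightarrow> nat
   \<Rightarrow> (real \<Rightarrow> real) \<Rightarrow> real \<Rightarrow> real \<Rightarrow> real \<Rightarrow> (nat \<times> nat \<Rightarrow> real)
   \<Rightarrow> (nat \<times> nat \<Rightarrow> 's) \<Rightarrow> nat \<Rightarrow> (nat \<times> nat \<Rightarrow> real) \<times> (nat \<times> nat \<Rightarrow> real)" where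
  "lamb_iter h k gl b \<phi> \<eta> \<beta>2 \<epsilon> x1 \<omega> 0 = (x1, (\<lambda>_. 0))"
| "lamb_iter h k gl b \<phi> \<eta> \<beta>2 \<epsilon> x1 \<omega> (Suc n) =
    (let t = Suc n;
         x = fst (lamb_iter h k gl b \<phi> \<eta> \<beta>2 \<epsilon> x1 \<omega> n);
         vprev = snd (lamb_iter h k gl b \<phi> \<eta> \<beta>2 \<epsilon> x1 \<omega> n);
         g = batch_grad gl b \<omega> t x;
         v = (\<lambda>c. \<beta>2 * vprev c + (1 - \<beta>2) * (g c)^2);
         vh = (\<lambda>c. v c / (1 - \<beta>2 ^ t));
         r = (\<lambda>c. g c / (sqrt (vh c) + \<epsilon>));
         x' = (\<lambda>(i, j). if i < h \<and> j < k
                 then x (i, j) - \<eta> * \<phi> (bnorm k x i) / bnorm k r i * r (i, j)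
                 else 0)
     in (x', v))"

definition lamb_x where
  "lamb_x h k gl b \<phi> \<eta> \<beta>2 \<epsilon> x1 \<omega> t = fst (lamb_iter h k gl b \<phi> \<eta> \<beta>2 \<epsilon> x1 \<omega> (t - 1))"

end

theory Submission
  imports Defs
begin

text \<open>
  Because \<open>\<nabla>\<^sub>i \<ell>\<close> is Lipschitz in the \<open>i\<close>-th block, one step satisfies
  \<open>f(x\<^sub>t\<^sub>+\<^sub>1) \<le> f(x\<^sub>t) - \<eta> \<Sum>\<^sub>i \<phi>\<^sub>i \<rho>\<^sub>i + \<eta>\<^sup>2 \<alpha>\<^sub>u\<^sup>2 \<parallel>L\<parallel>\<^sub>1 / 2\<close>, where
  \<open>\<rho>\<^sub>i = \<langle>\<nabla>\<^sub>i f(x\<^sub>t), r\<^sup>(\<^sup>i\<^sup>)\<rangle> / \<parallel>r\<^sup>(\<^sup>i\<^sup>)\<parallel>\<close>. Replacing \<open>\<nabla>\<^sub>i f\<close> by the batch gradient costs only the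
  batch error \<open>e\<^sub>i\<close>, and \<open>\<langle>g, r\<rangle> / \<parallel>r\<parallel>\<close> is bounded below uniformly in \<open>\<epsilon>\<close>: by
  \<open>\<parallel>g\<parallel>\<^sub>1 / \<surd>k\<close> if \<open>\<beta>\<^sub>2 = 0\<close> (Cauchy-Schwarz and Chebyshev's sum inequality, as \<open>|r\<^sub>j|\<close> and the
  denominator both increase with \<open>|g\<^sub>j|\<close>), and by \<open>\<parallel>g\<parallel>\<^sup>2 / (2 G \<surd>(k / (1 - \<beta>\<^sub>2)))\<close> in general
  (distinguish \<open>\<epsilon> \<le> G\<close> from \<open>\<epsilon> > G\<close>). Telescoping gives a pathwise bound in which
  only the batch errors are random, and their conditional expectations are at most
  \<open>\<parallel>\<sigma>\<parallel>\<^sub>1 / \<surd>T\<close>.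

  Since \<open>\<phi>\<close> need not be measurable, neither need the iterates be, and a non-integrable summand has
  Bochner integral \<open>0\<close>. The pathwise bound is therefore restricted to the measurable summands and the
  batches are integrated out one at a time, last batch first, so that the errors are only ever
  integrated over a single batch with the past frozen.
\<close>

subsection \<open>Block norms and normalized directions\<close>

lemma bnorm_eq_L2_set: "bnorm k x i = L2_set (\<lambda>j. x (i, j)) {..<k}"
  by (simp add: bnorm_def L2_set_def)

lemma bnorm_nonneg: "0 \<le> bnorm k x i"
  by (simp add: bnorm_eq_L2_set)

lemma bnorm_power2: "(bnorm k x i)\<^sup>2 = (\<Sum>j<k. (x (i, j))\<^sup>2)"
  by (simp add: bnorm_def sum_nonneg)

lemma bnorm_eq_0_iff: "bnorm k x i = 0 \<longleftrightarrow> (\<forall>j<k. x (i, j) = 0)"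
  by (auto simp: bnorm_eq_L2_set L2_set_eq_0_iff)

lemma bnorm_mono:
  assumes "\<And>j. j < k \<Longrightarrow> \<bar>x (i, j)\<bar> \<le> \<bar>y (i, j)\<bar>"
  shows "bnorm k x i \<le> bnorm k y i"
  unfolding bnorm_def using assms by (intro real_sqrt_le_mono sum_mono) (simp add: abs_le_square_iff)

lemma bnorm_scale: "bnorm k (\<lambda>c. a * x c) i = \<bar>a\<bar> * bnorm k x i"
  by (simp add: bnorm_def power_mult_distrib sum_distrib_left[symmetric] real_sqrt_mult)

lemma abs_component_le_bnorm: "j < k \<Longrightarrow> \<bar>x (i, j)\<bar> \<le> bnorm k x i"
  using member_le_L2_set[of "{..<k}" j "\<lambda>j. \<bar>x (i, j)\<bar>"]
  by (simp add: bnorm_eq_L2_set L2_set_def)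

lemma bnorm_le_sum_abs: "bnorm k x i \<le> (\<Sum>j<k. \<bar>x (i, j)\<bar>)"
  by (simp add: bnorm_eq_L2_set L2_set_le_sum_abs)

lemma abs_block_inner_le: "\<bar>\<Sum>j<k. x (i, j) * y (i, j)\<bar> \<le> bnorm k x i * bnorm k y i"
proof -
  have "\<bar>\<Sum>j<k. x (i, j) * y (i, j)\<bar> \<le> (\<Sum>j<k. \<bar>x (i, j)\<bar> * \<bar>y (i, j)\<bar>)"
    by (rule order_trans[OF sum_abs]) (simp add: abs_mult)
  also have "\<dots> \<le> bnorm k x i * bnorm k y i"
    unfolding bnorm_eq_L2_set by (rule L2_set_mult_ineq)
  finally show ?thesis .
qed

lemma sum_abs_le_sqrt_bnorm: "(\<Sum>j<k. \<bar>x (i, j)\<bar>) \<le> sqrt (real k) * bnorm k x i"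
  using L2_set_mult_ineq[of "\<lambda>_. 1" "\<lambda>j. x (i, j)" "{..<k}"]
  by (simp add: bnorm_eq_L2_set L2_set_constant)

lemma finite_idx [simp]: "finite (idx h k)"
  by (simp add: idx_def)

lemma sum_idx: "(\<Sum>c\<in>idx h k. F c) = (\<Sum>i<h. \<Sum>j<k. F (i, j))"
  by (simp add: idx_def sum.cartesian_product)

lemma vecs_fun_upd: "x \<in> vecs h k \<Longrightarrow> c \<in> idx h k \<Longrightarrow> x(c := u) \<in> vecs h k"
  by (auto simp: vecs_def)

text \<open>Chebyshev's sum inequality without an order on the index set: that \<open>w\<close> and
  \<open>p\<close> are similarly ordered is expressed pairwise, and summing these nonnegative
  products over all ordered pairs gives twice the claim.\<close>

lemma Chebyshev_sum_finite:
  fixes w p :: "'a \<Rightarrow> real"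
  assumes "\<And>i j. i \<in> A \<Longrightarrow> j \<in> A \<Longrightarrow> 0 \<le> (w i - w j) * (p i - p j)"
  shows "(\<Sum>i\<in>A. w i) * (\<Sum>i\<in>A. p i) \<le> real (card A) * (\<Sum>i\<in>A. w i * p i)"
proof -
  have "0 \<le> (\<Sum>i\<in>A. \<Sum>j\<in>A. (w i - w j) * (p i - p j))"
    by (intro sum_nonneg assms)
  also have "\<dots> = (\<Sum>i\<in>A. \<Sum>j\<in>A. w i * p i) + (\<Sum>i\<in>A. \<Sum>j\<in>A. w j * p j)
      - (\<Sum>i\<in>A. \<Sum>j\<in>A. w i * p j) - (\<Sum>i\<in>A. \<Sum>j\<in>A. w j * p i)"
    by (simp add: algebra_simps sum.distrib sum_subtractf)
  also have "(\<Sum>i\<in>A. \<Sum>j\<in>A. w j * p i) = (\<Sum>i\<in>A. \<Sum>j\<in>A. w i * p j)"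
    by (rule sum.swap)
  also have "(\<Sum>i\<in>A. \<Sum>j\<in>A. w i * p j) = (\<Sum>i\<in>A. w i) * (\<Sum>i\<in>A. p i)"
    by (simp add: sum_product)
  finally show ?thesis
    by (simp add: sum_distrib_left[symmetric] mult.commute)
qed

text \<open>Writing \<open>|g| = sqrt w * (sqrt w * |r|)\<close>, Cauchy-Schwarz bounds the squared
  sum of \<open>|g|\<close> by the sum of \<open>w\<close> times the sum of
  \<open>w * r^2 = g * r\<close>. Chebyshev then bounds the sum of \<open>w\<close> times the sum of
  \<open>r^2\<close> by \<open>k\<close> times the same inner product, so \<open>\<epsilon>\<close>
  does not enter the constant.\<close>

lemma sum_abs_mult_bnorm_normalized_le:
  fixes g r w :: "nat \<times> nat \<Rightarrow> real"
  assumes w: "\<And>j. j < k \<Longrightarrow> w (i, j) = \<bar>g (i, j)\<bar> + \<epsilon>" and "0 < \<epsilon>"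
    and r: "\<And>j. j < k \<Longrightarrow> r (i, j) = g (i, j) / w (i, j)"
  shows "(\<Sum>j<k. \<bar>g (i, j)\<bar>) * bnorm k r i \<le> sqrt (real k) * (\<Sum>j<k. g (i, j) * r (i, j))"
proof (rule power2_le_imp_le)
  define p where "p j = (r (i, j))\<^sup>2" for j
  define v where "v j = w (i, j)" for j
  have vpos: "0 < v j" if "j < k" for j
    using w[OF that] \<open>0 < \<epsilon>\<close> by (simp add: v_def)
  have gr: "g (i, j) * r (i, j) = v j * p j" if "j < k" for j
    using r[OF that] vpos[OF that] by (simp add: v_def p_def power2_eq_square)
  have gabs: "\<bar>g (i, j)\<bar> = sqrt (v j) * (sqrt (v j) * \<bar>r (i, j)\<bar>)" if "j < k" for j
    using r[OF that] vpos[OF that] by (simp add: v_def abs_mult mult.assoc[symmetric])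
  have cs: "(\<Sum>j<k. \<bar>g (i, j)\<bar>)\<^sup>2 \<le> (\<Sum>j<k. v j) * (\<Sum>j<k. v j * p j)"
  proof -
    have "(\<Sum>j<k. \<bar>g (i, j)\<bar>)\<^sup>2 = (\<Sum>j<k. sqrt (v j) * (sqrt (v j) * \<bar>r (i, j)\<bar>))\<^sup>2"
      using gabs by simp
    also have "\<dots> \<le> (\<Sum>j<k. (sqrt (v j))\<^sup>2) * (\<Sum>j<k. (sqrt (v j) * \<bar>r (i, j)\<bar>)\<^sup>2)"
      by (rule Cauchy_Schwarz_ineq_sum)
    also have "\<dots> = (\<Sum>j<k. v j) * (\<Sum>j<k. v j * p j)"
      using vpos by (simp add: power_mult_distrib p_def less_imp_le)
    finally show ?thesis .
  qed
  \<comment> \<open>In this form \<open>|r|\<close> visibly increases with the denominator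
    \<open>v\<close>, so \<open>v\<close> and \<open>p = r^2\<close> are similarly ordered.\<close>
  have r_abs: "\<bar>r (i, j)\<bar> = 1 - \<epsilon> / v j" if "j < k" for j
  proof -
    have "\<bar>r (i, j)\<bar> = (v j - \<epsilon>) / v j"
      using r[OF that] w[OF that] vpos[OF that] by (simp add: v_def)
    then show ?thesis
      using vpos[OF that] by (simp add: diff_divide_distrib)
  qed
  have mono: "0 \<le> (v a - v b) * (p a - p b)" if "a < k" "b < k" for a b
  proof -
    have *: "p a \<le> p b" if ab: "a < k" "b < k" and le: "v a \<le> v b" for a b
    proof -
      have "\<bar>r (i, a)\<bar> = 1 - \<epsilon> / v a"
        by (rule r_abs[OF ab(1)])
      also have "\<dots> \<le> 1 - \<epsilon> / v b"
        using le vpos[OF ab(1)] \<open>0 < \<epsilon>\<close> by (simp add: frac_le)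
      also have "\<dots> = \<bar>r (i, b)\<bar>"
        by (rule r_abs[OF ab(2), symmetric])
      finally show ?thesis
        by (simp add: p_def abs_le_square_iff)
    qed
    show ?thesis
      using *[of a b] *[of b a] that by (cases "v a \<le> v b") (auto simp: mult_nonpos_nonpos)
  qed
  have ch: "(\<Sum>j<k. v j) * (\<Sum>j<k. p j) \<le> real k * (\<Sum>j<k. v j * p j)"
    using Chebyshev_sum_finite[of "{..<k}" v p] mono by simp
  have nn: "0 \<le> (\<Sum>j<k. v j * p j)"
    using vpos by (intro sum_nonneg) (simp add: p_def less_imp_le)
  have "((\<Sum>j<k. \<bar>g (i, j)\<bar>) * bnorm k r i)\<^sup>2 = (\<Sum>j<k. \<bar>g (i, j)\<bar>)\<^sup>2 * (\<Sum>j<k. p j)"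
    by (simp add: power_mult_distrib bnorm_power2 p_def)
  also have "\<dots> \<le> (\<Sum>j<k. v j) * (\<Sum>j<k. v j * p j) * (\<Sum>j<k. p j)"
    by (intro mult_right_mono cs sum_nonneg) (simp add: p_def)
  also have "\<dots> = (\<Sum>j<k. v j * p j) * ((\<Sum>j<k. v j) * (\<Sum>j<k. p j))"
    by simp
  also have "\<dots> \<le> (\<Sum>j<k. v j * p j) * (real k * (\<Sum>j<k. v j * p j))"
    by (rule mult_left_mono[OF ch nn])
  also have "\<dots> = (sqrt (real k) * (\<Sum>j<k. v j * p j))\<^sup>2"
    by (simp add: power_mult_distrib power2_eq_square)
  also have "(\<Sum>j<k. v j * p j) = (\<Sum>j<k. g (i, j) * r (i, j))"
    using gr by simp
  finally show "((\<Sum>j<k. \<bar>g (i, j)\<bar>) * bnorm k r i)\<^sup>2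
      \<le> (sqrt (real k) * (\<Sum>j<k. g (i, j) * r (i, j)))\<^sup>2" .
  show "0 \<le> sqrt (real k) * (\<Sum>j<k. g (i, j) * r (i, j))"
    using nn gr by simp
qed

text \<open>Since \<open>w \<le> G + \<epsilon>\<close>, the inner product dominates
  \<open>(bnorm k g i)^2 / (G + \<epsilon>)\<close>. The norm of \<open>r\<close> has two bounds,
  \<open>sqrt (k / (1 - \<beta>))\<close> and \<open>bnorm k g i / \<epsilon>\<close>; the first
  serves small \<open>\<epsilon>\<close>, the second large \<open>\<epsilon>\<close>.\<close>

lemma bnorm_power2_mult_bnorm_normalized_le:
  fixes g r w :: "nat \<times> nat \<Rightarrow> real"
  assumes \<beta>: "0 \<le> \<beta>" "\<beta> < 1" and "0 < \<epsilon>"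
    and w_ge: "\<And>j. j < k \<Longrightarrow> sqrt (1 - \<beta>) * \<bar>g (i, j)\<bar> + \<epsilon> \<le> w (i, j)"
    and w_le: "\<And>j. j < k \<Longrightarrow> w (i, j) \<le> G + \<epsilon>"
    and g_le: "\<And>j. j < k \<Longrightarrow> \<bar>g (i, j)\<bar> \<le> G" and "0 \<le> G"
    and r: "\<And>j. j < k \<Longrightarrow> r (i, j) = g (i, j) / w (i, j)"
  shows "(bnorm k g i)\<^sup>2 * bnorm k r i
    \<le> 2 * (G * sqrt (real k / (1 - \<beta>))) * (\<Sum>j<k. g (i, j) * r (i, j))"
proof -
  have wpos: "\<epsilon> \<le> w (i, j)" "0 < w (i, j)" if "j < k" for j
  proof -
    have "0 \<le> sqrt (1 - \<beta>) * \<bar>g (i, j)\<bar>" using \<beta> by simp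
    then show "\<epsilon> \<le> w (i, j)" "0 < w (i, j)"
      using w_ge[OF that] \<open>0 < \<epsilon>\<close> by linarith+
  qed
  have gr: "g (i, j) * r (i, j) = (g (i, j))\<^sup>2 / w (i, j)" if "j < k" for j
    using r[OF that] by (simp add: power2_eq_square)
  have low: "(bnorm k g i)\<^sup>2 \<le> (G + \<epsilon>) * (\<Sum>j<k. g (i, j) * r (i, j))"
    unfolding bnorm_power2 sum_distrib_left
  proof (rule sum_mono)
    fix j assume "j \<in> {..<k}"
    then have j: "j < k" by simp
    have "(g (i, j))\<^sup>2 = w (i, j) * ((g (i, j))\<^sup>2 / w (i, j))"
      using wpos[OF j] by simp
    also have "\<dots> \<le> (G + \<epsilon>) * ((g (i, j))\<^sup>2 / w (i, j))"
      using w_le[OF j] wpos[OF j] by (intro mult_right_mono) auto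
    finally show "(g (i, j))\<^sup>2 \<le> (G + \<epsilon>) * (g (i, j) * r (i, j))"
      using gr[OF j] by simp
  qed
  have inner_nn: "0 \<le> (\<Sum>j<k. g (i, j) * r (i, j))"
    using gr wpos by (intro sum_nonneg) (simp add: less_imp_le)
  have r_eps: "bnorm k r i \<le> bnorm k g i / \<epsilon>"
  proof -
    have "bnorm k r i \<le> bnorm k (\<lambda>c. (1 / \<epsilon>) * g c) i"
    proof (rule bnorm_mono)
      fix j assume j: "j < k"
      have "\<bar>g (i, j)\<bar> / w (i, j) \<le> \<bar>g (i, j)\<bar> / \<epsilon>"
        using wpos[OF j] \<open>0 < \<epsilon>\<close> by (intro divide_left_mono) auto
      then show "\<bar>r (i, j)\<bar> \<le> \<bar>(1 / \<epsilon>) * g (i, j)\<bar>"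
        using wpos[OF j] \<open>0 < \<epsilon>\<close> by (simp add: r[OF j] abs_mult)
    qed
    then show ?thesis
      using \<open>0 < \<epsilon>\<close> by (simp only: bnorm_scale) simp
  qed
  have bnorm_const: "bnorm k (\<lambda>_. a) i = sqrt (real k) * \<bar>a\<bar>" for a
    by (simp add: bnorm_eq_L2_set L2_set_constant)
  have r_max: "bnorm k r i \<le> sqrt (real k / (1 - \<beta>))"
  proof -
    have "bnorm k r i \<le> bnorm k (\<lambda>_. 1 / sqrt (1 - \<beta>)) i"
    proof (rule bnorm_mono)
      fix j assume j: "j < k"
      have "\<bar>g (i, j)\<bar> / w (i, j) \<le> 1 / sqrt (1 - \<beta>)"
        using w_ge[OF j] wpos[OF j] \<beta> \<open>0 < \<epsilon>\<close> by (simp add: field_simps)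
      then show "\<bar>r (i, j)\<bar> \<le> \<bar>1 / sqrt (1 - \<beta>)\<bar>"
        using wpos[OF j] \<beta> by (simp add: r[OF j])
    qed
    then show ?thesis
      using \<beta> by (simp add: bnorm_const real_sqrt_divide)
  qed
  show ?thesis
  proof (cases "\<epsilon> \<le> G")
    case True
    have "(bnorm k g i)\<^sup>2 * bnorm k r i
        \<le> ((G + \<epsilon>) * (\<Sum>j<k. g (i, j) * r (i, j))) * sqrt (real k / (1 - \<beta>))"
      using inner_nn \<open>0 \<le> G\<close> \<open>0 < \<epsilon>\<close> by (intro mult_mono low r_max bnorm_nonneg) auto
    also have "\<dots> \<le> ((2 * G) * (\<Sum>j<k. g (i, j) * r (i, j))) * sqrt (real k / (1 - \<beta>))"
      using True inner_nn \<beta> by (intro mult_right_mono) auto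
    finally show ?thesis by (simp add: mult_ac)
  next
    case False
    have gG: "bnorm k g i \<le> G * sqrt (real k)"
      using bnorm_mono[of k g i "\<lambda>_. G"] g_le \<open>0 \<le> G\<close> by (simp add: bnorm_const mult.commute)
    have "(bnorm k g i)\<^sup>2 * bnorm k r i
        \<le> ((G + \<epsilon>) * (\<Sum>j<k. g (i, j) * r (i, j))) * (bnorm k g i / \<epsilon>)"
      using inner_nn \<open>0 \<le> G\<close> \<open>0 < \<epsilon>\<close> by (intro mult_mono low r_eps bnorm_nonneg) auto
    \<comment> \<open>Now \<open>G + \<epsilon> \<le> 2 * \<epsilon>\<close>, which the division by
      \<open>\<epsilon>\<close> cancels; the surviving factor \<open>bnorm k g i\<close> is at most
      \<open>G * sqrt k\<close>.\<close>
    also have "\<dots> \<le> ((2 * \<epsilon>) * (\<Sum>j<k. g (i, j) * r (i, j))) * (bnorm k g i / \<epsilon>)"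
      using False inner_nn \<open>0 < \<epsilon>\<close> by (intro mult_right_mono) (auto simp: bnorm_nonneg)
    also have "\<dots> = 2 * bnorm k g i * (\<Sum>j<k. g (i, j) * r (i, j))"
      using \<open>0 < \<epsilon>\<close> by simp
    also have "\<dots> \<le> 2 * (G * sqrt (real k / (1 - \<beta>))) * (\<Sum>j<k. g (i, j) * r (i, j))"
    proof (intro mult_right_mono mult_left_mono inner_nn)
      have "sqrt (real k) \<le> sqrt (real k / (1 - \<beta>))"
        using \<beta> by (intro real_sqrt_le_mono) (simp add: field_simps)
      then show "bnorm k g i \<le> G * sqrt (real k / (1 - \<beta>))"
        using gG \<open>0 \<le> G\<close> by (meson mult_left_mono order_trans)
    qed simp
    finally show ?thesis .
  qed
qed

subsection \<open>Descent for block-smooth functions\<close>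

text \<open>The function is given through its partial derivatives only; derivatives along lines are
  recovered from the Lipschitz bound. A gradient block is controlled by the same block of the
  displacement, so the descent estimate has no cross terms between blocks.\<close>

locale block_smooth =
  fixes h k :: nat and f :: "(nat \<times> nat \<Rightarrow> real) \<Rightarrow> real"
    and gf :: "(nat \<times> nat \<Rightarrow> real) \<Rightarrow> nat \<times> nat \<Rightarrow> real" and L :: "nat \<Rightarrow> real"
  assumes partial_deriv: "\<And>x c. x \<in> vecs h k \<Longrightarrow> c \<in> idx h k \<Longrightarrow>
      ((\<lambda>u. f (x(c := u))) has_real_derivative gf x c) (at (x c))"
    and grad_Lipschitz: "\<And>x y i. x \<in> vecs h k \<Longrightarrow> y \<in> vecs h k \<Longrightarrow> i < h \<Longrightarrow>
      bnorm k (\<lambda>c. gf x c - gf y c) i \<le> L i * bnorm k (\<lambda>c. x c - y c) i"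
    and L_nonneg: "\<And>i. i < h \<Longrightarrow> 0 \<le> L i"
begin

lemma partial_deriv_upd:
  assumes "x \<in> vecs h k" "c \<in> idx h k"
  shows "((\<lambda>u. f (x(c := u))) has_real_derivative gf (x(c := u)) c) (at u)"
  using partial_deriv[OF vecs_fun_upd[OF assms] assms(2), of u] by simp

text \<open>Changing one coordinate at a time loses a factor depending on the dimension, but the error is
  still quadratic, which suffices to identify directional derivatives.\<close>

lemma linearization_error:
  assumes z: "z \<in> vecs h k" and d: "d \<in> vecs h k"
  shows "\<bar>f (\<lambda>c. z c + d c) - f z - (\<Sum>c\<in>idx h k. gf z c * d c)\<bar>
    \<le> (\<Sum>c\<in>idx h k. \<bar>d c\<bar> * (L (fst c) * bnorm k d (fst c)))"
proof -
  \<comment> \<open>Induction over the set \<open>S\<close> of coordinates already moved from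
    \<open>z\<close> to \<open>z + d\<close>.\<close>
  have "\<bar>f (\<lambda>c. z c + (if c \<in> S then d c else 0)) - f z - (\<Sum>c\<in>S. gf z c * d c)\<bar>
    \<le> (\<Sum>c\<in>S. \<bar>d c\<bar> * (L (fst c) * bnorm k d (fst c)))"
    if "finite S" "S \<subseteq> idx h k" for S
    using that
  proof (induction S rule: finite_induct)
    case empty
    show ?case by simp
  next
    case (insert a S)
    define y where "y = (\<lambda>c. z c + (if c \<in> S then d c else 0))"
    have yv: "y \<in> vecs h k"
      using z d by (simp add: y_def vecs_def)
    have a: "a \<in> idx h k" and aS: "a \<notin> S" using insert by auto
    have upd: "(\<lambda>c. z c + (if c \<in> insert a S then d c else 0)) = y(a := z a + d a)"
      and y_upd: "y(a := z a) = y"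
      using aS by (auto simp: y_def fun_eq_iff)
    \<comment> \<open>Mean value theorem in coordinate \<open>a\<close>; the sign of
      \<open>d a\<close> decides which endpoint is the left one. As \<open>u\<close> stays within
      \<open>|d a|\<close> of \<open>z a\<close>, the point \<open>y(a := u)\<close> differs from
      \<open>z\<close> by at most \<open>|d|\<close> in every coordinate.\<close>
    have "\<exists>u. \<bar>u - z a\<bar> \<le> \<bar>d a\<bar> \<and> f (y(a := z a + d a)) - f (y(a := z a)) = d a * gf (y(a := u)) a"
    proof (cases "d a" "0 :: real" rule: linorder_cases)
      case equal then show ?thesis by (intro exI[of _ "z a"]) simp
    next
      case greater
      then obtain u where "z a < u" "u < z a + d a"
        "f (y(a := z a + d a)) - f (y(a := z a)) = (z a + d a - z a) * gf (y(a := u)) a"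
        using MVT2[of "z a" "z a + d a" "\<lambda>u. f (y(a := u))" "\<lambda>u. gf (y(a := u)) a"]
          partial_deriv_upd[OF yv a] by auto
      then show ?thesis by (intro exI[of _ u]) auto
    next
      case less
      then obtain u where "z a + d a < u" "u < z a"
        "f (y(a := z a)) - f (y(a := z a + d a)) = (z a - (z a + d a)) * gf (y(a := u)) a"
        using MVT2[of "z a + d a" "z a" "\<lambda>u. f (y(a := u))" "\<lambda>u. gf (y(a := u)) a"]
          partial_deriv_upd[OF yv a] by auto
      then show ?thesis by (intro exI[of _ u]) auto
    qed
    then obtain u where u: "\<bar>u - z a\<bar> \<le> \<bar>d a\<bar>"
      "f (y(a := z a + d a)) - f y = d a * gf (y(a := u)) a"
      using y_upd by metis
    obtain i j where ij: "a = (i, j)" "i < h" "j < k"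
      using a by (auto simp: idx_def)
    have "\<bar>gf (y(a := u)) a - gf z a\<bar> \<le> bnorm k (\<lambda>c. gf (y(a := u)) c - gf z c) i"
      using abs_component_le_bnorm[OF ij(3), of "\<lambda>c. gf (y(a := u)) c - gf z c" i] ij by simp
    also have "\<dots> \<le> L i * bnorm k (\<lambda>c. (y(a := u)) c - z c) i"
      by (intro grad_Lipschitz vecs_fun_upd yv a z ij)
    also have "\<dots> \<le> L i * bnorm k d i"
      using u(1) by (intro mult_left_mono bnorm_mono L_nonneg ij) (auto simp: y_def)
    finally have "\<bar>d a\<bar> * \<bar>gf (y(a := u)) a - gf z a\<bar> \<le> \<bar>d a\<bar> * (L (fst a) * bnorm k d (fst a))"
      using ij by (intro mult_left_mono) auto
    then have "\<bar>f (y(a := z a + d a)) - f y - gf z a * d a\<bar>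
        \<le> \<bar>d a\<bar> * (L (fst a) * bnorm k d (fst a))"
      unfolding u(2) by (simp add: abs_mult[symmetric] algebra_simps)
    moreover have "\<bar>f y - f z - (\<Sum>c\<in>S. gf z c * d c)\<bar>
        \<le> (\<Sum>c\<in>S. \<bar>d c\<bar> * (L (fst c) * bnorm k d (fst c)))"
      using insert unfolding y_def by auto
    ultimately show ?case
      unfolding upd using insert(1,2) by (simp add: sum.insert)
  qed
  from this[of "idx h k"]
  have *: "\<bar>f (\<lambda>c. z c + (if c \<in> idx h k then d c else 0)) - f z - (\<Sum>c\<in>idx h k. gf z c * d c)\<bar>
    \<le> (\<Sum>c\<in>idx h k. \<bar>d c\<bar> * (L (fst c) * bnorm k d (fst c)))" by simp
  have "(\<lambda>c. z c + (if c \<in> idx h k then d c else 0)) = (\<lambda>c. z c + d c)"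
    using d by (auto simp: vecs_def fun_eq_iff)
  with * show ?thesis by simp
qed

text \<open>For the displacement \<open>\<delta> * d\<close> the linearization error is at most
  \<open>E * \<delta>^2\<close>, one factor coming from the coordinate and one from the block norm.
  Divided by \<open>\<delta>\<close> it still tends to 0.\<close>

lemma has_derivative_along_line:
  assumes x: "x \<in> vecs h k" and d: "d \<in> vecs h k"
  shows "((\<lambda>s. f (\<lambda>c. x c + s * d c)) has_real_derivative
    (\<Sum>c\<in>idx h k. gf (\<lambda>c. x c + s * d c) c * d c)) (at s)"
proof -
  define z where "z = (\<lambda>c. x c + s * d c)"
  define D where "D = (\<Sum>c\<in>idx h k. gf z c * d c)"
  define E where "E = (\<Sum>c\<in>idx h k. \<bar>d c\<bar> * (L (fst c) * bnorm k d (fst c)))"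
  have zv: "z \<in> vecs h k" using x d by (simp add: z_def vecs_def)
  have quot: "\<bar>(f (\<lambda>c. x c + (s + \<delta>) * d c) - f (\<lambda>c. x c + s * d c)) / \<delta> - D\<bar> \<le> E * \<bar>\<delta>\<bar>"
    if "\<delta> \<noteq> 0" for \<delta>
  proof -
    have "(\<lambda>c. \<delta> * d c) \<in> vecs h k" using d by (simp add: vecs_def)
    from linearization_error[OF zv this]
    have "\<bar>f (\<lambda>c. z c + \<delta> * d c) - f z - (\<Sum>c\<in>idx h k. gf z c * (\<delta> * d c))\<bar>
      \<le> (\<Sum>c\<in>idx h k. \<bar>\<delta> * d c\<bar> * (L (fst c) * bnorm k (\<lambda>c. \<delta> * d c) (fst c)))" .
    also have "\<dots> = E * \<bar>\<delta>\<bar> * \<bar>\<delta>\<bar>"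
      unfolding E_def bnorm_scale by (simp add: sum_distrib_left sum_distrib_right abs_mult mult_ac)
    also have "(\<Sum>c\<in>idx h k. gf z c * (\<delta> * d c)) = \<delta> * D"
      by (simp add: D_def sum_distrib_left mult_ac)
    also have "(\<lambda>c. z c + \<delta> * d c) = (\<lambda>c. x c + (s + \<delta>) * d c)"
      by (simp add: z_def algebra_simps)
    finally have "\<bar>f (\<lambda>c. x c + (s + \<delta>) * d c) - f z - \<delta> * D\<bar> / \<bar>\<delta>\<bar> \<le> E * \<bar>\<delta>\<bar>"
      using that by (simp add: divide_le_eq)
    also have "\<bar>f (\<lambda>c. x c + (s + \<delta>) * d c) - f z - \<delta> * D\<bar> / \<bar>\<delta>\<bar>
        = \<bar>(f (\<lambda>c. x c + (s + \<delta>) * d c) - f z) / \<delta> - D\<bar>"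
      using that by (simp add: abs_divide[symmetric] diff_divide_distrib)
    finally show ?thesis by (simp add: z_def)
  qed
  have "((\<lambda>\<delta>. (f (\<lambda>c. x c + (s + \<delta>) * d c) - f (\<lambda>c. x c + s * d c)) / \<delta> - D) \<longlongrightarrow> 0) (at 0)"
  proof (rule Lim_null_comparison)
    show "eventually (\<lambda>\<delta>. norm ((f (\<lambda>c. x c + (s + \<delta>) * d c) - f (\<lambda>c. x c + s * d c)) / \<delta> - D)
        \<le> E * \<bar>\<delta>\<bar>) (at 0)"
      using quot by (auto simp: eventually_at intro!: exI[of _ 1])
    show "((\<lambda>\<delta>. E * \<bar>\<delta>\<bar>) \<longlongrightarrow> 0) (at (0::real))"
      by (auto intro!: tendsto_eq_intros)
  qed
  then have "(\<lambda>\<delta>. (f (\<lambda>c. x c + (s + \<delta>) * d c) - f (\<lambda>c. x c + s * d c)) / \<delta>) \<midarrow>0\<rightarrow> D"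
    by (rule LIM_zero_cancel)
  then show ?thesis
    by (simp add: DERIV_def D_def z_def)
qed

lemma descent:
  assumes x: "x \<in> vecs h k" and y: "y \<in> vecs h k"
  shows "f y \<le> f x + (\<Sum>c\<in>idx h k. gf x c * (y c - x c))
    + (\<Sum>i<h. L i / 2 * (bnorm k (\<lambda>c. y c - x c) i)\<^sup>2)"
proof -
  define d where "d = (\<lambda>c. y c - x c)"
  have d: "d \<in> vecs h k" using x y by (simp add: d_def vecs_def)
  define Q where "Q = (\<Sum>i<h. L i * (bnorm k d i)\<^sup>2)"
  define D where "D = (\<Sum>c\<in>idx h k. gf x c * d c)"
  \<comment> \<open>Up to the constant \<open>f x\<close>, this is \<open>f\<close> on the segment
    minus the claimed upper bound. The Lipschitz bound makes its derivative nonpositive for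
    \<open>s \<ge> 0\<close>, and the antiderivative of \<open>s * Q\<close> supplies the sharp
    factor 1/2.\<close>
  define \<psi> where "\<psi> s = f (\<lambda>c. x c + s * d c) - s * D - s\<^sup>2 / 2 * Q" for s
  have "\<psi> 1 \<le> \<psi> 0"
  proof (rule DERIV_nonpos_imp_nonincreasing[where f = \<psi>])
    fix s :: real assume s: "0 \<le> s"
    define z where "z = (\<lambda>c. x c + s * d c)"
    have zv: "z \<in> vecs h k" using x d by (simp add: z_def vecs_def)
    have "(\<psi> has_real_derivative (\<Sum>c\<in>idx h k. gf z c * d c) - D - s * Q) (at s)"
      unfolding \<psi>_def z_def
      by (rule derivative_eq_intros has_derivative_along_line[OF x d] | simp)+
    moreover have "(\<Sum>c\<in>idx h k. gf z c * d c) - D - s * Q \<le> 0"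
    proof -
      have "(\<Sum>c\<in>idx h k. gf z c * d c) - D = (\<Sum>i<h. \<Sum>j<k. (gf z (i, j) - gf x (i, j)) * d (i, j))"
        by (simp add: D_def sum_idx sum_subtractf left_diff_distrib)
      also have "\<dots> \<le> (\<Sum>i<h. s * (L i * (bnorm k d i)\<^sup>2))"
      proof (rule sum_mono)
        fix i assume "i \<in> {..<h}"
        then have i: "i < h" by simp
        have "(\<Sum>j<k. (gf z (i, j) - gf x (i, j)) * d (i, j))
            \<le> bnorm k (\<lambda>c. gf z c - gf x c) i * bnorm k d i"
          using abs_block_inner_le[of "\<lambda>c. gf z c - gf x c" i d k] by simp
        also have "\<dots> \<le> (L i * bnorm k (\<lambda>c. z c - x c) i) * bnorm k d i"
          by (intro mult_right_mono grad_Lipschitz zv x i bnorm_nonneg)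
        also have "bnorm k (\<lambda>c. z c - x c) i = s * bnorm k d i"
          using s by (simp add: z_def bnorm_scale)
        finally show "(\<Sum>j<k. (gf z (i, j) - gf x (i, j)) * d (i, j)) \<le> s * (L i * (bnorm k d i)\<^sup>2)"
          by (simp add: power2_eq_square mult_ac)
      qed
      also have "\<dots> = s * Q" by (simp add: Q_def sum_distrib_left)
      finally show ?thesis by simp
    qed
    ultimately show "\<exists>y. (\<psi> has_real_derivative y) (at s) \<and> y \<le> 0" by blast
  qed simp
  then show ?thesis
    by (simp add: \<psi>_def D_def Q_def d_def sum_divide_distrib)
qed

end

subsection \<open>Integrating out independent batches\<close>

lemma product_prob_space_const: "prob_space P \<Longrightarrow> product_prob_space (\<lambda>_. P)"
  by (rule product_prob_spaceI)

text \<open>Coordinates outside \<open>S\<close> receive the factor 1, which integrates to 1, so the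
  product formula over all of \<open>J\<close> applies.\<close>

lemma integral_PiM_prod_subset:
  fixes F :: "'i \<Rightarrow> 's \<Rightarrow> real"
  assumes "prob_space P" "finite J" "S \<subseteq> J" and F: "\<And>i. i \<in> S \<Longrightarrow> integrable P (F i)"
  shows "(\<integral>q. (\<Prod>i\<in>S. F i (q i)) \<partial>PiM J (\<lambda>_. P)) = (\<Prod>i\<in>S. \<integral>s. F i s \<partial>P)"
proof -
  interpret P0: prob_space P by fact
  interpret Q: product_prob_space "\<lambda>_. P" J by (rule product_prob_space_const) fact
  define H where "H i = (if i \<in> S then F i else (\<lambda>_. 1))" for i
  have JS: "J \<inter> S = S" using assms(3) by auto
  have "(\<Prod>i\<in>S. F i (q i)) = (\<Prod>i\<in>J. H i (q i))" for q
    using prod.inter_restrict[OF \<open>finite J\<close>, of "\<lambda>i. F i (q i)" S]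
    unfolding JS H_def by (auto intro!: prod.cong)
  then have "(\<integral>q. (\<Prod>i\<in>S. F i (q i)) \<partial>PiM J (\<lambda>_. P)) = (\<Prod>i\<in>J. \<integral>s. H i s \<partial>P)"
    using F by (subst Q.product_integral_prod[OF \<open>finite J\<close>, symmetric]) (auto simp: H_def)
  also have "\<dots> = (\<Prod>i\<in>S. \<integral>s. F i s \<partial>P)"
    using prod.inter_restrict[OF \<open>finite J\<close>, of "\<lambda>i. \<integral>s. F i s \<partial>P" S]
    unfolding JS H_def by (auto intro!: prod.cong simp: P0.prob_space)
  finally show ?thesis .
qed

text \<open>By independence and zero mean the mixed moments vanish, so the second moment of the sum
  is \<open>card J\<close> times that of one summand. Nonnegativity of the variance of the absolute
  value passes from the second to the first moment.\<close>

lemma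
  fixes Y :: "'s \<Rightarrow> real"
  assumes "prob_space P" "finite J" and Y[measurable]: "Y \<in> borel_measurable P"
    and bound: "\<And>s. s \<in> space P \<Longrightarrow> \<bar>Y s\<bar> \<le> K"
    and mean: "(\<integral>s. Y s \<partial>P) = 0" and var: "(\<integral>s. (Y s)\<^sup>2 \<partial>P) \<le> \<sigma>\<^sup>2"
  shows integrable_abs_sum_iid: "integrable (PiM J (\<lambda>_. P)) (\<lambda>q. \<bar>\<Sum>a\<in>J. Y (q a)\<bar>)" (is ?A)
    and integral_abs_sum_iid_le:
      "(\<integral>q. \<bar>\<Sum>a\<in>J. Y (q a)\<bar> \<partial>PiM J (\<lambda>_. P)) \<le> sqrt (real (card J)) * \<bar>\<sigma>\<bar>" (is ?B)
proof -
  interpret P0: prob_space P by fact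
  interpret Q: product_prob_space "\<lambda>_. P" J by (rule product_prob_space_const) fact
  let ?Q = "PiM J (\<lambda>_. P)"
  have comp: "q a \<in> space P" if "q \<in> space ?Q" "a \<in> J" for q a
    using that by (auto simp: space_PiM)
  have K: "0 \<le> K"
    using bound P0.not_empty by fastforce
  have intY: "integrable P Y" "integrable P (\<lambda>s. (Y s)\<^sup>2)"
  proof -
    show "integrable P Y"
      using bound by (intro P0.integrable_const_bound[where B = K]) auto
    show "integrable P (\<lambda>s. (Y s)\<^sup>2)"
    proof (intro P0.integrable_const_bound[where B = "K\<^sup>2"] AE_I2)
      fix s assume "s \<in> space P"
      then show "norm ((Y s)\<^sup>2) \<le> K\<^sup>2"
        using bound[of s] K by (simp add: abs_le_square_iff[symmetric])
    qed simp
  qed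
  have YJ[measurable]: "(\<lambda>q. Y (q a)) \<in> borel_measurable ?Q" if "a \<in> J" for a
    using that by measurable
  have prod_int: "integrable ?Q (\<lambda>q. Y (q a) * Y (q b))" if "a \<in> J" "b \<in> J" for a b
    using that K
    by (intro Q.P.integrable_const_bound[where B = "K * K"] AE_I2 borel_measurable_times YJ)
       (auto simp: abs_mult comp intro!: mult_mono bound)
  define Z where "Z q = (\<Sum>a\<in>J. Y (q a))" for q
  have Z2: "(Z q)\<^sup>2 = (\<Sum>a\<in>J. \<Sum>b\<in>J. Y (q a) * Y (q b))" for q
    by (simp add: Z_def power2_eq_square sum_product)
  have Zmeas[measurable]: "Z \<in> borel_measurable ?Q"
    unfolding Z_def by measurable
  have Zint: "integrable ?Q Z"
    unfolding Z_def using bound comp YJ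
    by (intro Bochner_Integration.integrable_sum Q.P.integrable_const_bound[where B = K]) auto
  have Z2int: "integrable ?Q (\<lambda>q. (Z q)\<^sup>2)"
    unfolding Z2 by (intro Bochner_Integration.integrable_sum prod_int)
  have off: "(\<integral>q. Y (q a) * Y (q b) \<partial>?Q) = 0" if "a \<in> J" "b \<in> J" "a \<noteq> b" for a b
    using integral_PiM_prod_subset[OF assms(1,2), of "{a, b}" "\<lambda>_. Y"] that intY mean by simp
  have diag: "(\<integral>q. Y (q a) * Y (q a) \<partial>?Q) = (\<integral>s. (Y s)\<^sup>2 \<partial>P)" if "a \<in> J" for a
    using integral_PiM_prod_subset[OF assms(1,2), of "{a}" "\<lambda>_ s. (Y s)\<^sup>2"] that intY
    by (simp add: power2_eq_square)
  have "(\<integral>q. (Z q)\<^sup>2 \<partial>?Q) = (\<Sum>a\<in>J. \<Sum>b\<in>J. \<integral>q. Y (q a) * Y (q b) \<partial>?Q)"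
    unfolding Z2 by (simp add: prod_int)
  also have "\<dots> = (\<Sum>a\<in>J. \<Sum>b\<in>J. if b = a then \<integral>s. (Y s)\<^sup>2 \<partial>P else 0)"
    using off diag by (intro sum.cong refl) auto
  also have "\<dots> = real (card J) * (\<integral>s. (Y s)\<^sup>2 \<partial>P)"
    using \<open>finite J\<close> by simp
  also have "\<dots> \<le> real (card J) * \<sigma>\<^sup>2"
    by (intro mult_left_mono var) simp
  finally have EZ2: "(\<integral>q. (Z q)\<^sup>2 \<partial>?Q) \<le> real (card J) * \<sigma>\<^sup>2" .
  have absint: "integrable ?Q (\<lambda>q. \<bar>Z q\<bar>)" using Zint by simp
  have "(\<integral>q. \<bar>Z q\<bar> \<partial>?Q)\<^sup>2 \<le> (\<integral>q. (Z q)\<^sup>2 \<partial>?Q)"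
    using Q.P.variance_eq[of "\<lambda>q. \<bar>Z q\<bar>"] Q.P.variance_positive[of "\<lambda>q. \<bar>Z q\<bar>"] absint Z2int by simp
  also note EZ2
  also have "real (card J) * \<sigma>\<^sup>2 = (sqrt (real (card J)) * \<bar>\<sigma>\<bar>)\<^sup>2"
    by (simp add: power_mult_distrib)
  finally have "(\<integral>q. \<bar>Z q\<bar> \<partial>?Q) \<le> sqrt (real (card J)) * \<bar>\<sigma>\<bar>"
    by (rule power2_le_imp_le) simp
  then show ?A ?B using absint by (simp_all add: Z_def)
qed

text \<open>The processes \<open>N\<close> need not be measurable: only \<open>W\<close> is integrated over more than one batch.\<close>

lemma integral_le_of_conditional_bounds:
  fixes W :: "(nat \<times> nat \<Rightarrow> 's) \<Rightarrow> real" and N :: "nat \<Rightarrow> (nat \<times> nat \<Rightarrow> 's) \<Rightarrow> real"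
  assumes "prob_space P"
    and "W \<in> borel_measurable (PiM ({1..n} \<times> {..<b}) (\<lambda>_. P))"
    and "\<And>\<omega>. \<omega> \<in> space (PiM ({1..n} \<times> {..<b}) (\<lambda>_. P)) \<Longrightarrow> \<bar>W \<omega>\<bar> \<le> K"
    and "\<And>\<omega>. \<omega> \<in> space (PiM ({1..n} \<times> {..<b}) (\<lambda>_. P)) \<Longrightarrow> W \<omega> \<le> B + (\<Sum>t\<in>{1..n}. N t \<omega>)"
    and adapted: "\<And>t \<omega> \<omega>'. 1 \<le> t \<Longrightarrow>
      (\<And>u m. 1 \<le> u \<Longrightarrow> u \<le> t \<Longrightarrow> m < b \<Longrightarrow> \<omega> (u, m) = \<omega>' (u, m)) \<Longrightarrow> N t \<omega> = N t \<omega>'"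
    and int: "\<And>t p. t < n \<Longrightarrow> p \<in> space (PiM ({1..t} \<times> {..<b}) (\<lambda>_. P)) \<Longrightarrow>
      integrable (PiM ({Suc t} \<times> {..<b}) (\<lambda>_. P))
        (\<lambda>q. N (Suc t) (merge ({1..t} \<times> {..<b}) ({Suc t} \<times> {..<b}) (p, q)))"
    and le: "\<And>t p. t < n \<Longrightarrow> p \<in> space (PiM ({1..t} \<times> {..<b}) (\<lambda>_. P)) \<Longrightarrow>
      (\<integral>q. N (Suc t) (merge ({1..t} \<times> {..<b}) ({Suc t} \<times> {..<b}) (p, q))
        \<partial>PiM ({Suc t} \<times> {..<b}) (\<lambda>_. P)) \<le> s"
  shows "(\<integral>\<omega>. W \<omega> \<partial>PiM ({1..n} \<times> {..<b}) (\<lambda>_. P)) \<le> B + real n * s"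
  using assms(2-4) int le
proof (induction n arbitrary: W B)
  case 0
  interpret product_prob_space "\<lambda>_. P" "{1..0::nat} \<times> {..<b}"
    by (rule product_prob_space_const) fact
  have "(\<integral>\<omega>. W \<omega> \<partial>PiM ({1..0} \<times> {..<b}) (\<lambda>_. P)) \<le> (\<integral>\<omega>. B \<partial>PiM ({1..0::nat} \<times> {..<b}) (\<lambda>_. P))"
    using 0 by (intro integral_mono P.integrable_const P.integrable_const_bound[where B = K and f = W]) auto
  also have "\<dots> = B" using P.prob_space by simp
  finally show ?case by simp
next
  case (Suc n)
  define I where "I = {1..n} \<times> {..<b}"
  define J where "J = {Suc n} \<times> {..<b}"
  have IJ: "{1..Suc n} \<times> {..<b} = I \<union> J" "I \<inter> J = {}" "finite I" "finite J"
    by (auto simp: I_def J_def)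
  interpret I: product_prob_space "\<lambda>_. P" I by (rule product_prob_space_const) fact
  interpret J: product_prob_space "\<lambda>_. P" J by (rule product_prob_space_const) fact
  interpret U: product_prob_space "\<lambda>_. P" "I \<union> J" by (rule product_prob_space_const) fact
  note prems = Suc.prems[unfolded IJ(1), folded I_def J_def]
  have Wm[measurable]: "W \<in> borel_measurable (PiM (I \<union> J) (\<lambda>_. P))"
    by (rule prems(1))
  have merge_sp: "merge I J (p, q) \<in> space (PiM (I \<union> J) (\<lambda>_. P))"
    if "p \<in> space (PiM I (\<lambda>_. P))" "q \<in> space (PiM J (\<lambda>_. P))" for p q
    using that by (auto simp: space_PiM PiE_iff merge_def extensional_def)
  have Wint: "integrable (PiM (I \<union> J) (\<lambda>_. P)) W"
    using prems(2) by (intro U.P.integrable_const_bound[where B = K]) auto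
  \<comment> \<open>Integrating out the last batch leaves a function of the earlier ones that
    satisfies the same hypotheses with \<open>B + s\<close> in place of \<open>B\<close>; hence the
    induction generalizes \<open>W\<close> and \<open>B\<close>.\<close>
  define W' where "W' p = (\<integral>q. W (merge I J (p, q)) \<partial>PiM J (\<lambda>_. P))" for p
  have sec_int: "integrable (PiM J (\<lambda>_. P)) (\<lambda>q. W (merge I J (p, q)))"
    if p: "p \<in> space (PiM I (\<lambda>_. P))" for p
    using p prems(2) merge_sp
    by (intro J.P.integrable_const_bound[where B = K] AE_I2) auto
  have W'm: "W' \<in> borel_measurable (PiM I (\<lambda>_. P))"
    unfolding W'_def by measurable
  have W'K: "\<bar>W' p\<bar> \<le> K" if p: "p \<in> space (PiM I (\<lambda>_. P))" for p
  proof -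
    have "\<bar>W' p\<bar> \<le> (\<integral>q. \<bar>W (merge I J (p, q))\<bar> \<partial>PiM J (\<lambda>_. P))"
      unfolding W'_def by (rule integral_abs_bound)
    also have "\<dots> \<le> (\<integral>q. K \<partial>PiM J (\<lambda>_. P))"
      using sec_int[OF p] p prems(2) merge_sp by (intro integral_mono) auto
    finally show ?thesis by (simp add: J.P.prob_space)
  qed
  have W'le: "W' p \<le> (B + s) + (\<Sum>t\<in>{1..n}. N t p)" if p: "p \<in> space (PiM I (\<lambda>_. P))" for p
  proof -
    \<comment> \<open>By adaptedness the earlier terms do not see the last batch, so they are
      constants in the inner integral.\<close>
    have N_eq: "N t (merge I J (p, q)) = N t p" if "t \<in> {1..n}" for t q
      using that by (intro adapted) (auto simp: merge_def I_def J_def)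
    have Nint: "integrable (PiM J (\<lambda>_. P)) (\<lambda>q. N (Suc n) (merge I J (p, q)))"
      using prems(4)[of n p] p by (simp add: I_def J_def)
    have "W' p \<le> (\<integral>q. B + (\<Sum>t\<in>{1..n}. N t p) + N (Suc n) (merge I J (p, q)) \<partial>PiM J (\<lambda>_. P))"
      unfolding W'_def
    proof (rule integral_mono)
      fix q assume q: "q \<in> space (PiM J (\<lambda>_. P))"
      show "W (merge I J (p, q)) \<le> B + (\<Sum>t\<in>{1..n}. N t p) + N (Suc n) (merge I J (p, q))"
        using prems(3)[OF merge_sp[OF p q]] N_eq by simp
    qed (use sec_int[OF p] Nint in auto)
    also have "\<dots> = B + (\<Sum>t\<in>{1..n}. N t p) + (\<integral>q. N (Suc n) (merge I J (p, q)) \<partial>PiM J (\<lambda>_. P))"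
      using Nint by (simp add: J.P.prob_space)
    also have "\<dots> \<le> B + (\<Sum>t\<in>{1..n}. N t p) + s"
      using prems(5)[of n p] p by (simp add: I_def J_def)
    finally show ?thesis by simp
  qed
  \<comment> \<open>Fubini is applied to \<open>W\<close> alone, which is measurable and
    bounded.\<close>
  have "(\<integral>\<omega>. W \<omega> \<partial>PiM (I \<union> J) (\<lambda>_. P)) = (\<integral>p. W' p \<partial>PiM I (\<lambda>_. P))"
    unfolding W'_def by (rule I.product_integral_fold[OF IJ(2-4) Wint])
  also have "\<dots> \<le> (B + s) + real n * s"
    using Suc.IH[of W' "B + s"] W'm W'K W'le Suc.prems(4,5) unfolding I_def by simp
  finally show ?case
    unfolding IJ(1) by (simp add: algebra_simps)
qed

subsection \<open>The iteration\<close>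

text \<open>Adaptedness of the iteration, which allows the past to be frozen while a later batch is
  integrated out.\<close>

lemma lamb_iter_cong:
  assumes "\<And>u m. 1 \<le> u \<Longrightarrow> u \<le> n \<Longrightarrow> m < b \<Longrightarrow> \<omega> (u, m) = \<omega>' (u, m)"
  shows "lamb_iter h k gl b \<phi> \<eta> \<beta>2 \<epsilon> x1 \<omega> n = lamb_iter h k gl b \<phi> \<eta> \<beta>2 \<epsilon> x1 \<omega>' n"
  using assms
proof (induction n)
  case (Suc n)
  then have IH: "lamb_iter h k gl b \<phi> \<eta> \<beta>2 \<epsilon> x1 \<omega> n = lamb_iter h k gl b \<phi> \<eta> \<beta>2 \<epsilon> x1 \<omega>' n"
    by simp
  have bg: "batch_grad gl b \<omega> (Suc n) = batch_grad gl b \<omega>' (Suc n)"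
    using Suc.prems by (intro ext) (simp add: batch_grad_def)
  show ?case unfolding lamb_iter.simps Let_def IH bg by (rule refl)
qed simp

text \<open>One fixed problem instance; \<open>T\<close> is both the number of steps and the batch
  size. The bounds on \<open>\<phi>\<close> include the argument 0 because a block of an iterate may
  vanish.\<close>

locale lamb_problem = P: prob_space P for P :: "'s measure" +
  fixes h k T :: nat
    and lf :: "(nat \<times> nat \<Rightarrow> real) \<Rightarrow> 's \<Rightarrow> real"
    and gl :: "(nat \<times> nat \<Rightarrow> real) \<Rightarrow> 's \<Rightarrow> nat \<times> nat \<Rightarrow> real"
    and f :: "(nat \<times> nat \<Rightarrow> real) \<Rightarrow> real"
    and gf :: "(nat \<times> nat \<Rightarrow> real) \<Rightarrow> nat \<times> nat \<Rightarrow> real"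
    and L :: "nat \<Rightarrow> real" and \<sigma> :: "nat \<times> nat \<Rightarrow> real" and G \<beta>2 \<epsilon> :: real
    and \<phi> :: "real \<Rightarrow> real" and \<alpha>l \<alpha>u :: real and x1 xs :: "nat \<times> nat \<Rightarrow> real"
  assumes h: "1 \<le> h" and k: "1 \<le> k" and T: "1 \<le> T"
    and x1: "x1 \<in> vecs h k" and xs: "xs \<in> vecs h k"
    and lf_integrable: "\<And>x. x \<in> vecs h k \<Longrightarrow> integrable P (lf x)"
    and f_eq: "\<And>x. x \<in> vecs h k \<Longrightarrow> f x = (\<integral>s. lf x s \<partial>P)"
    and lf_deriv: "\<And>x s c. x \<in> vecs h k \<Longrightarrow> s \<in> space P \<Longrightarrow> c \<in> idx h k \<Longrightarrow>
      ((\<lambda>u. lf (x(c := u)) s) has_real_derivative gl x s c) (at (x c))"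
    and f_deriv: "\<And>x c. x \<in> vecs h k \<Longrightarrow> c \<in> idx h k \<Longrightarrow>
      ((\<lambda>u. f (x(c := u))) has_real_derivative gf x c) (at (x c))"
    and gl_measurable: "\<And>x c. x \<in> vecs h k \<Longrightarrow> c \<in> idx h k \<Longrightarrow>
      (\<lambda>s. gl x s c) \<in> borel_measurable P"
    and f_min: "\<And>x. x \<in> vecs h k \<Longrightarrow> f xs \<le> f x"
    and gl_Lipschitz: "\<And>x y s i. x \<in> vecs h k \<Longrightarrow> y \<in> vecs h k \<Longrightarrow> s \<in> space P \<Longrightarrow> i < h \<Longrightarrow>
      bnorm k (\<lambda>c. gl x s c - gl y s c) i \<le> L i * bnorm k (\<lambda>c. x c - y c) i"
    and gl_variance: "\<And>x c. x \<in> vecs h k \<Longrightarrow> c \<in> idx h k \<Longrightarrow>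
      (\<integral>s. (gl x s c - gf x c)\<^sup>2 \<partial>P) \<le> (\<sigma> c)\<^sup>2"
    and gl_bound: "\<And>x s c. x \<in> vecs h k \<Longrightarrow> s \<in> space P \<Longrightarrow> c \<in> idx h k \<Longrightarrow> \<bar>gl x s c\<bar> \<le> G"
    and \<beta>2: "0 \<le> \<beta>2" "\<beta>2 < 1" and \<epsilon>: "0 < \<epsilon>"
    and \<alpha>: "0 < \<alpha>l" "\<alpha>l \<le> \<alpha>u" and \<phi>: "\<And>v. 0 \<le> v \<Longrightarrow> \<alpha>l \<le> \<phi> v \<and> \<phi> v \<le> \<alpha>u"
begin

section \<open>The expected gradient inherits the bounds of the samples\<close>

lemma gl_integrable: "x \<in> vecs h k \<Longrightarrow> c \<in> idx h k \<Longrightarrow> integrable P (\<lambda>s. gl x s c)"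
  using gl_bound gl_measurable by (intro P.integrable_const_bound[where B = G]) auto

text \<open>Unbiasedness by differentiating under the integral: the difference quotients along
  \<open>\<delta> n\<close> converge pointwise, and by the mean value theorem each is a partial
  derivative at an intermediate point, hence dominated by \<open>G\<close>.\<close>

lemma gf_eq_expectation:
  assumes x: "x \<in> vecs h k" and c: "c \<in> idx h k"
  shows "gf x c = (\<integral>s. gl x s c \<partial>P)"
proof -
  define \<delta> where "\<delta> n = inverse (real (Suc n))" for n
  define q where "q n s = (lf (x(c := x c + \<delta> n)) s - lf x s) / \<delta> n" for n s
  have \<delta>_pos: "0 < \<delta> n" for n by (simp add: \<delta>_def)
  have \<delta>_lim: "filterlim \<delta> (at 0) sequentially"
    unfolding filterlim_at \<delta>_def[abs_def] using LIMSEQ_inverse_real_of_nat by auto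
  have upd: "x(c := u) \<in> vecs h k" for u by (rule vecs_fun_upd[OF x c])
  have q_int: "integrable P (q n)" for n
    unfolding q_def using lf_integrable[OF upd] lf_integrable[OF x] by simp
  have "(\<lambda>n. \<integral>s. q n s \<partial>P) \<longlonglongrightarrow> (\<integral>s. gl x s c \<partial>P)"
  proof (rule integral_dominated_convergence[where w = "\<lambda>_. G"])
    show "(\<lambda>s. gl x s c) \<in> borel_measurable P" by (rule gl_measurable[OF x c])
    show "q n \<in> borel_measurable P" for n using q_int by auto
    show "AE s in P. (\<lambda>n. q n s) \<longlonglongrightarrow> gl x s c"
    proof (rule AE_I2)
      fix s assume s: "s \<in> space P"
      have "((\<lambda>d. (lf (x(c := x c + d)) s - lf (x(c := x c)) s) / d) \<longlongrightarrow> gl x s c) (at 0)"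
        using lf_deriv[OF x s c] by (simp only: DERIV_def)
      from filterlim_compose[OF this \<delta>_lim] show "(\<lambda>n. q n s) \<longlonglongrightarrow> gl x s c"
        by (simp add: q_def)
    qed
    show "AE s in P. norm (q n s) \<le> G" for n
    proof (rule AE_I2)
      fix s assume s: "s \<in> space P"
      have "((\<lambda>u. lf (x(c := u)) s) has_real_derivative gl (x(c := u)) s c) (at u)" for u
        using lf_deriv[OF upd s c, of u] by simp
      then obtain u where
        "lf (x(c := x c + \<delta> n)) s - lf (x(c := x c)) s = (x c + \<delta> n - x c) * gl (x(c := u)) s c"
        using MVT2[of "x c" "x c + \<delta> n" "\<lambda>u. lf (x(c := u)) s" "\<lambda>u. gl (x(c := u)) s c"] \<delta>_pos[of n]
        by auto
      then have "q n s = gl (x(c := u)) s c"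
        using \<delta>_pos[of n] by (simp add: q_def)
      then show "norm (q n s) \<le> G" using gl_bound[OF upd s c] by simp
    qed
  qed simp
  moreover have "(\<integral>s. q n s \<partial>P) = (f (x(c := x c + \<delta> n)) - f (x(c := x c))) / \<delta> n" for n
    unfolding q_def using lf_integrable[OF upd] lf_integrable[OF x] f_eq[OF upd] f_eq[OF x] by simp
  moreover have "(\<lambda>n. (f (x(c := x c + \<delta> n)) - f (x(c := x c))) / \<delta> n) \<longlonglongrightarrow> gf x c"
    using f_deriv[OF x c] \<delta>_lim unfolding DERIV_def by (rule filterlim_compose)
  ultimately show ?thesis using LIMSEQ_unique by simp
qed

lemma gf_bound:
  assumes "x \<in> vecs h k" "c \<in> idx h k"
  shows "\<bar>gf x c\<bar> \<le> G"
proof -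
  have "\<bar>\<integral>s. gl x s c \<partial>P\<bar> \<le> (\<integral>s. \<bar>gl x s c\<bar> \<partial>P)" by (rule integral_abs_bound)
  also have "\<dots> \<le> (\<integral>s. G \<partial>P)"
    using gl_integrable[OF assms] gl_bound[OF assms(1) _ assms(2)] by (intro integral_mono) auto
  finally show ?thesis by (simp add: gf_eq_expectation[OF assms] P.prob_space)
qed

lemma G_nonneg: "0 \<le> G"
  using gf_bound[OF x1, of "(0, 0)"] h k by (force simp: idx_def)

text \<open>The Lipschitz condition is tested on the origin and a unit vector of block
  \<open>i\<close>.\<close>

lemma L_nonneg: "i < h \<Longrightarrow> 0 \<le> L i"
proof -
  assume i: "i < h"
  define y where "y = (\<lambda>c :: nat \<times> nat. if c = (i, 0) then 1 else 0 :: real)"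
  have y: "y \<in> vecs h k" and z: "(\<lambda>_. 0) \<in> vecs h k"
    using i k by (auto simp: vecs_def idx_def y_def)
  obtain s where s: "s \<in> space P" using P.not_empty by auto
  have "(bnorm k y i)\<^sup>2 = (\<Sum>j<k. if j = 0 then 1 else 0)"
    unfolding bnorm_power2 by (intro sum.cong) (auto simp: y_def)
  then have "(bnorm k y i)\<^sup>2 = 1" using k by simp
  then have "bnorm k y i = 1"
    using bnorm_nonneg[of k y i] by (simp add: power2_eq_1_iff)
  then have "bnorm k (\<lambda>c. gl y s c - gl (\<lambda>_. 0) s c) i \<le> L i"
    using gl_Lipschitz[OF y z s i] by simp
  then show ?thesis using bnorm_nonneg order_trans by blast
qed

text \<open>Jensen's inequality for the block norm, by duality: the difference \<open>v\<close> of
  expected gradients is paired with itself, one factor is written as an expectation, Cauchy-Schwarz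
  is applied for each sample, and one factor \<open>bnorm k v i\<close> is cancelled.\<close>

lemma gf_Lipschitz:
  assumes x: "x \<in> vecs h k" and y: "y \<in> vecs h k" and i: "i < h"
  shows "bnorm k (\<lambda>c. gf x c - gf y c) i \<le> L i * bnorm k (\<lambda>c. x c - y c) i"
proof -
  define v where "v = (\<lambda>c. gf x c - gf y c)"
  define w where "w s c = gl x s c - gl y s c" for s c
  define B where "B = L i * bnorm k (\<lambda>c. x c - y c) i"
  have c: "(i, j) \<in> idx h k" if "j < k" for j using i that by (simp add: idx_def)
  have w_int: "integrable P (\<lambda>s. w s (i, j))" if "j < k" for j
    unfolding w_def using gl_integrable[OF x c[OF that]] gl_integrable[OF y c[OF that]] by simp
  have v_eq: "v (i, j) = (\<integral>s. w s (i, j) \<partial>P)" if "j < k" for j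
    unfolding v_def w_def using gl_integrable[OF x c[OF that]] gl_integrable[OF y c[OF that]]
    by (simp add: gf_eq_expectation x y c[OF that])
  have "(bnorm k v i)\<^sup>2 = (\<Sum>j<k. v (i, j) * (\<integral>s. w s (i, j) \<partial>P))"
    unfolding bnorm_power2 using v_eq by (simp add: power2_eq_square)
  also have "\<dots> = (\<integral>s. (\<Sum>j<k. v (i, j) * w s (i, j)) \<partial>P)"
    using w_int by simp
  also have "\<dots> \<le> (\<integral>s. bnorm k v i * B \<partial>P)"
  proof (rule integral_mono)
    show "integrable P (\<lambda>s. \<Sum>j<k. v (i, j) * w s (i, j))"
      by (intro Bochner_Integration.integrable_sum integrable_mult_right w_int) simp
    fix s assume s: "s \<in> space P"
    have "(\<Sum>j<k. v (i, j) * w s (i, j)) \<le> bnorm k v i * bnorm k (w s) i"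
      using abs_block_inner_le[of v i "w s" k] by simp
    also have "\<dots> \<le> bnorm k v i * B"
      unfolding B_def w_def by (intro mult_left_mono gl_Lipschitz x y s i bnorm_nonneg)
    finally show "(\<Sum>j<k. v (i, j) * w s (i, j)) \<le> bnorm k v i * B" .
  qed simp
  also have "\<dots> = bnorm k v i * B" by (simp add: P.prob_space)
  finally have "bnorm k v i * bnorm k v i \<le> bnorm k v i * B" by (simp add: power2_eq_square)
  moreover have "0 \<le> B"
    unfolding B_def by (intro mult_nonneg_nonneg L_nonneg i bnorm_nonneg)
  ultimately have "bnorm k v i \<le> B"
    using bnorm_nonneg[of k v i] by (cases "bnorm k v i = 0") auto
  then show ?thesis by (simp add: v_def B_def)
qed

sublocale block_smooth h k f gf L
  by unfold_locales (auto intro: f_deriv gf_Lipschitz L_nonneg)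

lemma gf_minimizer:
  assumes "x \<in> vecs h k" "f x = f xs" and c: "c \<in> idx h k"
  shows "gf x c = 0"
  using assms f_min[OF vecs_fun_upd[OF assms(1) c]]
  by (intro DERIV_local_min[OF f_deriv[OF assms(1) c], of 1]) auto

section \<open>Step size, trajectory and second-moment estimates\<close>

definition gap :: real where "gap = f x1 - f xs"

definition L1 :: real where "L1 = (\<Sum>i<h. \<bar>L i\<bar>)"

text \<open>When nonzero, this makes \<open>T * \<eta>^2 * \<alpha>u^2 * L1\<close> equal to
  \<open>2 * gap\<close>. For \<open>L1 = 0\<close> the division by zero makes it 0.\<close>

definition \<eta> :: real where "\<eta> = sqrt (2 * gap / (\<alpha>u\<^sup>2 * L1 * real T))"

definition M :: "(nat \<times> nat \<Rightarrow> 's) measure" where "M = PiM ({1..T} \<times> {..<T}) (\<lambda>_. P)"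

text \<open>\<open>X n\<close> and \<open>V n\<close> are \<open>x\<^sub>n\<^sub>+\<^sub>1\<close> and \<open>v\<^sub>n\<close>, while \<open>g n\<close> and \<open>R n\<close> are \<open>g\<^sub>n\<^sub>+\<^sub>1\<close> and \<open>r\<^sub>n\<^sub>+\<^sub>1\<close>.\<close>

definition X where "X n \<omega> = fst (lamb_iter h k gl T \<phi> \<eta> \<beta>2 \<epsilon> x1 \<omega> n)"

definition V where "V n \<omega> = snd (lamb_iter h k gl T \<phi> \<eta> \<beta>2 \<epsilon> x1 \<omega> n)"

definition g where "g n \<omega> = batch_grad gl T \<omega> (Suc n) (X n \<omega>)"

definition R where "R n \<omega> = (\<lambda>c. g n \<omega> c / (sqrt (V (Suc n) \<omega> c / (1 - \<beta>2 ^ Suc n)) + \<epsilon>))"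

text \<open>The l1 norm fits the per-coordinate variance bounds. The point \<open>x\<close> is a
  separate argument so that it can stay fixed while batch \<open>t\<close> is integrated
  out.\<close>

definition noise where
  "noise t \<omega> x = (\<Sum>c\<in>idx h k. \<bar>batch_grad gl T \<omega> t x c - gf x c\<bar>)"

lemma gap_nonneg: "0 \<le> gap"
  using f_min[OF x1] by (simp add: gap_def)

lemma L1_nonneg: "0 \<le> L1"
  by (simp add: L1_def sum_nonneg)

lemma L1_eq: "L1 = (\<Sum>i<h. L i)"
  using L_nonneg by (simp add: L1_def)

lemma \<eta>_nonneg: "0 \<le> \<eta>"
  using gap_nonneg L1_nonneg by (simp add: \<eta>_def)

lemma V_Suc: "V (Suc n) \<omega> c = \<beta>2 * V n \<omega> c + (1 - \<beta>2) * (g n \<omega> c)\<^sup>2"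
  by (simp add: V_def g_def X_def Let_def)

lemma X_0: "X 0 \<omega> = x1"
  by (simp add: X_def)

lemma X_Suc: "X (Suc n) \<omega> (i, j) = (if i < h \<and> j < k
    then X n \<omega> (i, j) - \<eta> * \<phi> (bnorm k (X n \<omega>) i) / bnorm k (R n \<omega>) i * R n \<omega> (i, j) else 0)"
  by (simp add: R_def g_def X_def V_def Let_def)

lemma X_vecs: "X n \<omega> \<in> vecs h k"
proof (cases n)
  case 0 then show ?thesis using x1 by (simp add: X_0)
next
  case (Suc m) then show ?thesis by (auto simp: vecs_def X_Suc idx_def)
qed

lemma sample_in_space: "\<omega> \<in> space M \<Longrightarrow> 1 \<le> t \<Longrightarrow> t \<le> T \<Longrightarrow> m < T \<Longrightarrow> \<omega> (t, m) \<in> space P"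
  by (auto simp: M_def space_PiM PiE_iff)

lemma g_bound:
  assumes \<omega>: "\<omega> \<in> space M" and n: "n < T" and c: "c \<in> idx h k"
  shows "\<bar>g n \<omega> c\<bar> \<le> G"
proof -
  have "\<bar>\<Sum>m<T. gl (X n \<omega>) (\<omega> (Suc n, m)) c\<bar> \<le> (\<Sum>m<T. G)"
    using n \<omega> c by (intro order_trans[OF sum_abs] sum_mono gl_bound X_vecs sample_in_space) auto
  then show ?thesis
    using T by (simp add: g_def batch_grad_def abs_divide field_simps)
qed

lemma V_nonneg: "0 \<le> V n \<omega> c"
proof (induction n)
  case 0 show ?case by (simp add: V_def)
next
  case (Suc n) then show ?case using \<beta>2 by (simp add: V_Suc)
qed

text \<open>The factor \<open>1 - \<beta>2 ^ n\<close> is exactly what the bias correction divides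
  out, so the corrected second moment is at most \<open>G^2\<close>.\<close>

lemma V_le:
  assumes \<omega>: "\<omega> \<in> space M" and c: "c \<in> idx h k"
  shows "n \<le> T \<Longrightarrow> V n \<omega> c \<le> (1 - \<beta>2 ^ n) * G\<^sup>2"
proof (induction n)
  case 0 show ?case by (simp add: V_def)
next
  case (Suc n)
  have "(g n \<omega> c)\<^sup>2 \<le> G\<^sup>2"
    using g_bound[OF \<omega> _ c, of n] Suc.prems G_nonneg by (simp add: abs_le_square_iff[symmetric])
  then have "V (Suc n) \<omega> c \<le> \<beta>2 * ((1 - \<beta>2 ^ n) * G\<^sup>2) + (1 - \<beta>2) * G\<^sup>2"
    unfolding V_Suc using Suc \<beta>2 by (intro add_mono mult_left_mono) auto
  then show ?case by (simp add: algebra_simps)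
qed

lemma bias_pos: "0 < 1 - \<beta>2 ^ Suc n" "1 - \<beta>2 ^ Suc n \<le> 1"
  using \<beta>2 mult_left_le[of "\<beta>2 ^ n" \<beta>2] power_le_one[of \<beta>2 n] by auto

text \<open>The newest gradient enters \<open>V\<close> with weight \<open>1 - \<beta>2\<close>, and
  the bias correction, a division by a number in (0, 1], can only enlarge it; the upper bound comes
  from \<open>V_le\<close>.\<close>

lemma denominator_bounds:
  assumes \<omega>: "\<omega> \<in> space M" and n: "n < T" and c: "c \<in> idx h k"
  shows "sqrt (1 - \<beta>2) * \<bar>g n \<omega> c\<bar> \<le> sqrt (V (Suc n) \<omega> c / (1 - \<beta>2 ^ Suc n))" (is "_ \<le> ?s")
    and "sqrt (V (Suc n) \<omega> c / (1 - \<beta>2 ^ Suc n)) \<le> G"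
proof -
  have "(1 - \<beta>2) * (g n \<omega> c)\<^sup>2 \<le> V (Suc n) \<omega> c"
    using V_nonneg[of n \<omega> c] \<beta>2 by (simp add: V_Suc)
  also have "\<dots> \<le> V (Suc n) \<omega> c / (1 - \<beta>2 ^ Suc n)"
    using bias_pos[of n] V_nonneg[of "Suc n" \<omega> c] by (simp add: le_divide_eq mult_left_le del: power_Suc)
  finally have "sqrt ((1 - \<beta>2) * (g n \<omega> c)\<^sup>2) \<le> ?s" by (rule real_sqrt_le_mono)
  then show "sqrt (1 - \<beta>2) * \<bar>g n \<omega> c\<bar> \<le> ?s"
    by (simp add: real_sqrt_mult)
  have "V (Suc n) \<omega> c / (1 - \<beta>2 ^ Suc n) \<le> G\<^sup>2"
    using V_le[OF \<omega> c, of "Suc n"] n bias_pos[of n] by (simp add: divide_le_eq mult.commute del: power_Suc)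
  then show "?s \<le> G" using G_nonneg by (simp add: real_le_lsqrt)
qed

lemma denominator_pos: "0 < sqrt (V (Suc n) \<omega> c / (1 - \<beta>2 ^ Suc n)) + \<epsilon>"
proof -
  have "0 \<le> sqrt (V (Suc n) \<omega> c / (1 - \<beta>2 ^ Suc n))"
    using V_nonneg[of "Suc n" \<omega> c] bias_pos[of n] by (simp del: power_Suc)
  then show ?thesis using \<epsilon> by (rule add_nonneg_pos)
qed

section \<open>Alignment of the true gradient with the update direction\<close>

lemma g_eq_0_if_R_eq_0: "R n \<omega> c = 0 \<Longrightarrow> g n \<omega> c = 0"
  using denominator_pos[of n \<omega> c] by (auto simp: R_def)

text \<open>Replacing the batch gradient by \<open>gf x\<close> costs one block error, by
  Cauchy-Schwarz. If the block of \<open>R\<close> vanishes, the quotient is 0 by division by zero;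
  then the batch gradient vanishes there too, and \<open>u0\<close> makes the claim true.\<close>

lemma alignment_ge:
  assumes u: "u * bnorm k (R n \<omega>) i \<le> (\<Sum>j<k. g n \<omega> (i, j) * R n \<omega> (i, j))"
    and u0: "(\<And>j. j < k \<Longrightarrow> g n \<omega> (i, j) = 0) \<Longrightarrow> u \<le> 0"
  shows "u - bnorm k (\<lambda>c. g n \<omega> c - gf x c) i
    \<le> (\<Sum>j<k. gf x (i, j) * R n \<omega> (i, j)) / bnorm k (R n \<omega>) i"
proof (cases "bnorm k (R n \<omega>) i = 0")
  case True
  then have "u \<le> 0" using u0 g_eq_0_if_R_eq_0 by (simp add: bnorm_eq_0_iff)
  with True show ?thesis using bnorm_nonneg[of k "\<lambda>c. g n \<omega> c - gf x c" i] by simp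
next
  case False
  then have pos: "0 < bnorm k (R n \<omega>) i" using bnorm_nonneg[of k "R n \<omega>" i] by simp
  have "(\<Sum>j<k. (g n \<omega> (i, j) - gf x (i, j)) * R n \<omega> (i, j))
      \<le> bnorm k (\<lambda>c. g n \<omega> c - gf x c) i * bnorm k (R n \<omega>) i"
    using abs_block_inner_le[of "\<lambda>c. g n \<omega> c - gf x c" i "R n \<omega>" k] by simp
  with u have "(u - bnorm k (\<lambda>c. g n \<omega> c - gf x c) i) * bnorm k (R n \<omega>) i
      \<le> (\<Sum>j<k. gf x (i, j) * R n \<omega> (i, j))"
    by (simp add: algebra_simps sum_subtractf)
  with pos show ?thesis by (simp add: pos_le_divide_eq)
qed

text \<open>For \<open>\<beta>2 = 0\<close> the denominator is exactly
  \<open>|g| + \<epsilon>\<close>. Of the two block errors, one is the cost in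
  \<open>alignment_ge\<close> and the other comes from passing from the l1 norm of the batch
  gradient to that of \<open>gf x\<close>.\<close>

lemma alignment_beta2_zero:
  assumes "\<beta>2 = 0" and i: "i < h"
  shows "(\<Sum>j<k. \<bar>gf x (i, j)\<bar>) / sqrt (real k) - 2 * bnorm k (\<lambda>c. g n \<omega> c - gf x c) i
    \<le> (\<Sum>j<k. gf x (i, j) * R n \<omega> (i, j)) / bnorm k (R n \<omega>) i"
proof -
  define e where "e = (\<lambda>c. g n \<omega> c - gf x c)"
  have kpos: "0 < sqrt (real k)" using k by simp
  have R_eq: "R n \<omega> c = g n \<omega> c / (\<bar>g n \<omega> c\<bar> + \<epsilon>)" for c
    unfolding R_def V_Suc using \<open>\<beta>2 = 0\<close> by simp
  have "(\<Sum>j<k. \<bar>g n \<omega> (i, j)\<bar>) * bnorm k (R n \<omega>) i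
      \<le> sqrt (real k) * (\<Sum>j<k. g n \<omega> (i, j) * R n \<omega> (i, j))"
    using \<epsilon> R_eq
    by (intro sum_abs_mult_bnorm_normalized_le[where w = "\<lambda>c. \<bar>g n \<omega> c\<bar> + \<epsilon>" and \<epsilon> = \<epsilon>]) auto
  then have "(\<Sum>j<k. \<bar>g n \<omega> (i, j)\<bar>) / sqrt (real k) * bnorm k (R n \<omega>) i
      \<le> (\<Sum>j<k. g n \<omega> (i, j) * R n \<omega> (i, j))"
    using kpos by (simp add: divide_le_eq mult.commute)
  then have "(\<Sum>j<k. \<bar>g n \<omega> (i, j)\<bar>) / sqrt (real k) - bnorm k e i
      \<le> (\<Sum>j<k. gf x (i, j) * R n \<omega> (i, j)) / bnorm k (R n \<omega>) i"
    unfolding e_def by (rule alignment_ge) simp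
  moreover have "(\<Sum>j<k. \<bar>gf x (i, j)\<bar>) / sqrt (real k)
      \<le> (\<Sum>j<k. \<bar>g n \<omega> (i, j)\<bar>) / sqrt (real k) + bnorm k e i"
  proof -
    have "(\<Sum>j<k. \<bar>gf x (i, j)\<bar>) \<le> (\<Sum>j<k. \<bar>g n \<omega> (i, j)\<bar> + \<bar>e (i, j)\<bar>)"
      by (intro sum_mono) (simp add: e_def)
    also have "\<dots> \<le> (\<Sum>j<k. \<bar>g n \<omega> (i, j)\<bar>) + sqrt (real k) * bnorm k e i"
      using sum_abs_le_sqrt_bnorm[of e i k] by (simp add: sum.distrib)
    finally show ?thesis using kpos by (simp add: field_simps)
  qed
  ultimately show ?thesis by (simp add: e_def)
qed

text \<open>The constant of the general alignment bound and also a bound on every block of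
  \<open>gf\<close>. With \<open>d = h * k\<close> it equals the square root of
  \<open>G^2 * d / (h * (1 - \<beta>2))\<close>.\<close>

definition K where "K = G * sqrt (real k / (1 - \<beta>2))"

lemma K_nonneg: "0 \<le> K"
  using G_nonneg \<beta>2 by (simp add: K_def)

lemma bnorm_gf_le_K:
  assumes x: "x \<in> vecs h k" and i: "i < h"
  shows "bnorm k (gf x) i \<le> K"
proof -
  have "bnorm k (gf x) i \<le> bnorm k (\<lambda>_. G) i"
    using gf_bound[OF x] i G_nonneg by (intro bnorm_mono) (auto simp: idx_def)
  also have "\<dots> = G * sqrt (real k)"
    using G_nonneg by (simp add: bnorm_eq_L2_set L2_set_constant)
  also have "\<dots> \<le> K"
    unfolding K_def using \<beta>2 G_nonneg
    by (intro mult_left_mono real_sqrt_le_mono) (auto simp: field_simps)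
  finally show ?thesis .
qed

lemma alignment_general:
  assumes \<omega>: "\<omega> \<in> space M" and n: "n < T" and x: "x \<in> vecs h k" and i: "i < h"
  shows "(bnorm k (gf x) i)\<^sup>2 / (2 * K) - 2 * bnorm k (\<lambda>c. g n \<omega> c - gf x c) i
    \<le> (\<Sum>j<k. gf x (i, j) * R n \<omega> (i, j)) / bnorm k (R n \<omega>) i"
proof -
  define e where "e = (\<lambda>c. g n \<omega> c - gf x c)"
  have c: "(i, j) \<in> idx h k" if "j < k" for j using i that by (simp add: idx_def)
  have main: "(bnorm k (g n \<omega>) i)\<^sup>2 * bnorm k (R n \<omega>) i
      \<le> 2 * K * (\<Sum>j<k. g n \<omega> (i, j) * R n \<omega> (i, j))"
    unfolding K_def
    using \<beta>2 \<epsilon> G_nonneg denominator_bounds[OF \<omega> n c] g_bound[OF \<omega> n c]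
    by (intro bnorm_power2_mult_bnorm_normalized_le[where \<epsilon> = \<epsilon>
          and w = "\<lambda>c. sqrt (V (Suc n) \<omega> c / (1 - \<beta>2 ^ Suc n)) + \<epsilon>"])
       (auto simp: R_def simp del: power_Suc)
  have inner_nn: "0 \<le> (\<Sum>j<k. g n \<omega> (i, j) * R n \<omega> (i, j))"
  proof (rule sum_nonneg)
    fix j
    have "g n \<omega> (i, j) * R n \<omega> (i, j)
        = (g n \<omega> (i, j))\<^sup>2 / (sqrt (V (Suc n) \<omega> (i, j) / (1 - \<beta>2 ^ Suc n)) + \<epsilon>)"
      by (simp add: R_def power2_eq_square)
    then show "0 \<le> g n \<omega> (i, j) * R n \<omega> (i, j)"
      using denominator_pos[of n \<omega> "(i, j)"] by simp
  qed
  have "(bnorm k (g n \<omega>) i)\<^sup>2 / (2 * K) * bnorm k (R n \<omega>) i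
      \<le> (\<Sum>j<k. g n \<omega> (i, j) * R n \<omega> (i, j))"
    \<comment> \<open>For \<open>K = 0\<close> the quotient is 0 and nonnegativity of the inner
      product suffices.\<close>
    using main inner_nn K_nonneg by (cases "K = 0") (auto simp: divide_le_eq mult_ac)
  then have "(bnorm k (g n \<omega>) i)\<^sup>2 / (2 * K) - bnorm k e i
      \<le> (\<Sum>j<k. gf x (i, j) * R n \<omega> (i, j)) / bnorm k (R n \<omega>) i"
    unfolding e_def by (rule alignment_ge) (simp add: bnorm_def)
  moreover have "(bnorm k (gf x) i)\<^sup>2 / (2 * K) \<le> (bnorm k (g n \<omega>) i)\<^sup>2 / (2 * K) + bnorm k e i"
  proof (cases "K = 0")
    case True then show ?thesis by (simp add: bnorm_nonneg)
  next
    case False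
    \<comment> \<open>Expanding the square of \<open>gf x + e\<close> bounds the loss by
      \<open>2 * K * bnorm k e i\<close>; dividing by \<open>2 * K\<close> leaves the second block
      error.\<close>
    have "(bnorm k (gf x) i)\<^sup>2 + (2 * (\<Sum>j<k. gf x (i, j) * e (i, j)) + (bnorm k e i)\<^sup>2)
        = (bnorm k (g n \<omega>) i)\<^sup>2"
      unfolding bnorm_power2 sum_distrib_left sum.distrib[symmetric]
      by (intro sum.cong) (simp_all add: e_def power2_eq_square algebra_simps)
    moreover have "\<bar>\<Sum>j<k. gf x (i, j) * e (i, j)\<bar> \<le> K * bnorm k e i"
      by (rule order_trans[OF abs_block_inner_le])
         (intro mult_right_mono bnorm_gf_le_K x i bnorm_nonneg)
    ultimately have "(bnorm k (gf x) i)\<^sup>2 \<le> (bnorm k (g n \<omega>) i)\<^sup>2 + 2 * K * bnorm k e i"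
      using zero_le_power2[of "bnorm k e i"] by linarith
    then show ?thesis using False K_nonneg by (simp add: field_simps)
  qed
  ultimately show ?thesis by (simp add: e_def)
qed

text \<open>The abstract blockwise gain \<open>a\<close> lets both regimes of
  \<open>\<beta>2\<close> share the descent argument.\<close>

lemma one_step_decrease:
  assumes a: "\<And>i. i < h \<Longrightarrow> 0 \<le> a i"
    and align: "\<And>i. i < h \<Longrightarrow> a i - 2 * bnorm k (\<lambda>c. g n \<omega> c - gf (X n \<omega>) c) i
      \<le> (\<Sum>j<k. gf (X n \<omega>) (i, j) * R n \<omega> (i, j)) / bnorm k (R n \<omega>) i"
  shows "\<alpha>l * \<eta> * (\<Sum>i<h. a i) \<le> f (X n \<omega>) - f (X (Suc n) \<omega>) + \<eta>\<^sup>2 * \<alpha>u\<^sup>2 * L1 / 2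
    + 2 * \<alpha>u * \<eta> * noise (Suc n) \<omega> (X n \<omega>)"
proof -
  define x y where "x = X n \<omega>" and "y = X (Suc n) \<omega>"
  define d where "d = (\<lambda>c. y c - x c)"
  define \<Phi> where "\<Phi> i = \<phi> (bnorm k x i)" for i
  define \<rho> where "\<rho> i = (\<Sum>j<k. gf x (i, j) * R n \<omega> (i, j)) / bnorm k (R n \<omega>) i" for i
  define e where "e i = bnorm k (\<lambda>c. g n \<omega> c - gf x c) i" for i
  have \<Phi>: "\<alpha>l \<le> \<Phi> i" "\<Phi> i \<le> \<alpha>u" "0 \<le> \<Phi> i" for i
    using \<phi>[OF bnorm_nonneg[of k x i]] \<alpha> by (auto simp: \<Phi>_def)
  have d_eq: "d (i, j) = - (\<eta> * \<Phi> i / bnorm k (R n \<omega>) i) * R n \<omega> (i, j)" if "i < h" "j < k" for i j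
    using that by (simp add: d_def y_def X_Suc x_def \<Phi>_def)
  have lin: "(\<Sum>c\<in>idx h k. gf x c * d c) = (\<Sum>i<h. - (\<eta> * \<Phi> i * \<rho> i))"
    unfolding sum_idx
  proof (rule sum.cong)
    fix i assume "i \<in> {..<h}"
    then have "(\<Sum>j<k. gf x (i, j) * d (i, j))
        = (\<Sum>j<k. - (\<eta> * \<Phi> i / bnorm k (R n \<omega>) i) * (gf x (i, j) * R n \<omega> (i, j)))"
      by (intro sum.cong) (simp_all add: d_eq)
    also have "\<dots> = - (\<eta> * \<Phi> i * \<rho> i)"
      unfolding sum_distrib_left[symmetric] by (simp add: \<rho>_def)
    finally show "(\<Sum>j<k. gf x (i, j) * d (i, j)) = - (\<eta> * \<Phi> i * \<rho> i)" .
  qed simp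
  have quad: "(\<Sum>i<h. L i / 2 * (bnorm k d i)\<^sup>2) \<le> \<eta>\<^sup>2 * \<alpha>u\<^sup>2 * L1 / 2"
  proof -
    have "(\<Sum>i<h. L i / 2 * (bnorm k d i)\<^sup>2) \<le> (\<Sum>i<h. L i / 2 * (\<eta> * \<alpha>u)\<^sup>2)"
    proof (rule sum_mono)
      fix i assume "i \<in> {..<h}"
      then have i: "i < h" by simp
      have "bnorm k d i = bnorm k (\<lambda>c. - (\<eta> * \<Phi> i / bnorm k (R n \<omega>) i) * R n \<omega> c) i"
        using d_eq[OF i] by (simp add: bnorm_def)
      also have "\<dots> = \<bar>- (\<eta> * \<Phi> i / bnorm k (R n \<omega>) i)\<bar> * bnorm k (R n \<omega>) i"
        by (rule bnorm_scale)
      \<comment> \<open>Equality unless the block of \<open>R\<close> is zero, in which case the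
        block does not move.\<close>
      also have "\<dots> \<le> \<eta> * \<Phi> i"
        using \<eta>_nonneg \<Phi>(3)[of i] bnorm_nonneg[of k "R n \<omega>" i] by (simp add: abs_mult)
      also have "\<dots> \<le> \<eta> * \<alpha>u"
        by (intro mult_left_mono \<Phi> \<eta>_nonneg)
      finally show "L i / 2 * (bnorm k d i)\<^sup>2 \<le> L i / 2 * (\<eta> * \<alpha>u)\<^sup>2"
        using L_nonneg[OF i] bnorm_nonneg[of k d i] by (intro mult_left_mono power_mono) auto
    qed
    also have "\<dots> = \<eta>\<^sup>2 * \<alpha>u\<^sup>2 * L1 / 2"
      by (simp add: L1_eq sum_distrib_left sum_distrib_right sum_divide_distrib power_mult_distrib mult_ac)
    finally show ?thesis .
  qed
  have gain: "(\<Sum>i<h. \<alpha>l * a i - 2 * \<alpha>u * e i) \<le> (\<Sum>i<h. \<Phi> i * \<rho> i)"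
  proof (rule sum_mono)
    fix i assume "i \<in> {..<h}"
    then have i: "i < h" by simp
    \<comment> \<open>The factor \<open>\<Phi> i\<close> is bounded below on the nonnegative gain
      and above on the error, which is where the ratio \<open>\<alpha>u / \<alpha>l\<close>
      originates.\<close>
    have "\<alpha>l * a i - \<alpha>u * (2 * e i) \<le> \<Phi> i * a i - \<Phi> i * (2 * e i)"
      using \<Phi>[of i] a[OF i] bnorm_nonneg by (intro diff_mono mult_right_mono) (auto simp: e_def)
    also have "\<dots> = \<Phi> i * (a i - 2 * e i)" by (simp add: algebra_simps)
    also have "\<dots> \<le> \<Phi> i * \<rho> i"
      using align[OF i] \<Phi>(3)[of i] by (intro mult_left_mono) (auto simp: e_def \<rho>_def x_def)
    finally show "\<alpha>l * a i - 2 * \<alpha>u * e i \<le> \<Phi> i * \<rho> i" by simp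
  qed
  have e_le: "(\<Sum>i<h. e i) \<le> noise (Suc n) \<omega> x"
    unfolding noise_def sum_idx e_def
    by (intro sum_mono order_trans[OF bnorm_le_sum_abs]) (simp add: g_def x_def)
  have "f y \<le> f x + (\<Sum>c\<in>idx h k. gf x c * d c) + (\<Sum>i<h. L i / 2 * (bnorm k d i)\<^sup>2)"
    unfolding d_def by (rule descent) (simp_all add: x_def y_def X_vecs)
  also have "\<dots> \<le> f x - \<eta> * (\<Sum>i<h. \<Phi> i * \<rho> i) + \<eta>\<^sup>2 * \<alpha>u\<^sup>2 * L1 / 2"
  proof -
    have "(\<Sum>c\<in>idx h k. gf x c * d c) = - (\<eta> * (\<Sum>i<h. \<Phi> i * \<rho> i))"
      unfolding lin by (simp add: sum_negf sum_distrib_left mult.assoc)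
    with quad show ?thesis by linarith
  qed
  also have "\<dots> \<le> f x - \<eta> * (\<alpha>l * (\<Sum>i<h. a i) - 2 * \<alpha>u * (\<Sum>i<h. e i)) + \<eta>\<^sup>2 * \<alpha>u\<^sup>2 * L1 / 2"
    using mult_left_mono[OF gain \<eta>_nonneg] by (simp add: sum_subtractf sum_distrib_left)
  also have "\<dots> = f x - \<alpha>l * \<eta> * (\<Sum>i<h. a i) + 2 * \<alpha>u * \<eta> * (\<Sum>i<h. e i) + \<eta>\<^sup>2 * \<alpha>u\<^sup>2 * L1 / 2"
    by (simp add: algebra_simps)
  also have "\<dots> \<le> f x - \<alpha>l * \<eta> * (\<Sum>i<h. a i) + 2 * \<alpha>u * \<eta> * noise (Suc n) \<omega> x + \<eta>\<^sup>2 * \<alpha>u\<^sup>2 * L1 / 2"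
    using \<alpha> \<eta>_nonneg e_le by (intro add_mono mult_left_mono) auto
  finally show ?thesis by (simp add: x_def y_def)
qed

text \<open>At a fixed point each coordinate of the batch error is a mean of \<open>T\<close>
  bounded centred i.i.d. variables, so its expected absolute value is at most
  \<open>|\<sigma> c| / sqrt T\<close>.\<close>

lemma
  assumes x: "x \<in> vecs h k"
  shows noise_integrable: "integrable (PiM ({t} \<times> {..<T}) (\<lambda>_. P)) (\<lambda>q. noise t q x)" (is ?A)
    and noise_integral_le: "(\<integral>q. noise t q x \<partial>PiM ({t} \<times> {..<T}) (\<lambda>_. P))
      \<le> l1norm h k \<sigma> / sqrt (real T)" (is ?B)
proof -
  define J where "J = {t} \<times> {..<T}"
  have J: "finite J" "card J = T" by (simp_all add: J_def)
  define Y where "Y c s = gl x s c - gf x c" for c s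
  have eq: "\<bar>batch_grad gl T q t x c - gf x c\<bar> = \<bar>\<Sum>a\<in>J. Y c (q a)\<bar> / real T" for q c
  proof -
    have "(\<Sum>a\<in>J. Y c (q a)) = (\<Sum>m<T. Y c (q (t, m)))"
      using sum.cartesian_product[of "\<lambda>a b. Y c (q (a, b))" "{..<T}" "{t}"] by (simp add: J_def)
    also have "\<dots> = (\<Sum>m<T. gl x (q (t, m)) c) - real T * gf x c"
      by (simp add: Y_def sum_subtractf)
    finally have "batch_grad gl T q t x c - gf x c = (\<Sum>a\<in>J. Y c (q a)) / real T"
      using T by (simp add: batch_grad_def field_simps)
    then show ?thesis by simp
  qed
  have Y: "Y c \<in> borel_measurable P" "\<And>s. s \<in> space P \<Longrightarrow> \<bar>Y c s\<bar> \<le> G + G"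
    "(\<integral>s. Y c s \<partial>P) = 0" "(\<integral>s. (Y c s)\<^sup>2 \<partial>P) \<le> (\<sigma> c)\<^sup>2" if c: "c \<in> idx h k" for c
  proof -
    show "Y c \<in> borel_measurable P" using gl_measurable[OF x c] unfolding Y_def by measurable
    show "\<bar>Y c s\<bar> \<le> G + G" if "s \<in> space P" for s
      using gl_bound[OF x that c] gf_bound[OF x c] by (simp add: Y_def)
    show "(\<integral>s. Y c s \<partial>P) = 0"
      using gl_integrable[OF x c] by (simp add: Y_def gf_eq_expectation[OF x c] P.prob_space)
    show "(\<integral>s. (Y c s)\<^sup>2 \<partial>P) \<le> (\<sigma> c)\<^sup>2" using gl_variance[OF x c] by (simp add: Y_def)
  qed
  note int = integrable_abs_sum_iid[OF P.prob_space_axioms J(1) Y]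
  show ?A
    unfolding noise_def eq J_def[symmetric]
    by (intro Bochner_Integration.integrable_sum integrable_divide int)
  have "(\<integral>q. noise t q x \<partial>PiM J (\<lambda>_. P))
      = (\<Sum>c\<in>idx h k. (\<integral>q. \<bar>\<Sum>a\<in>J. Y c (q a)\<bar> \<partial>PiM J (\<lambda>_. P)) / real T)"
    unfolding noise_def eq using int by simp
  also have "\<dots> \<le> (\<Sum>c\<in>idx h k. sqrt (real T) * \<bar>\<sigma> c\<bar> / real T)"
    using integral_abs_sum_iid_le[OF P.prob_space_axioms J(1) Y]
    by (intro sum_mono divide_right_mono) (simp_all add: J)
  also have "\<dots> = l1norm h k \<sigma> / sqrt (real T)"
  proof -
    have "sqrt (real T) * \<bar>\<sigma> c\<bar> / real T = \<bar>\<sigma> c\<bar> / sqrt (real T)" for c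
      using sqrt_divide_self_eq[of "real T"] by (simp add: divide_inverse mult_ac)
    then show ?thesis by (simp add: l1norm_def sum_divide_distrib)
  qed
  finally show ?B by (simp add: J_def)
qed

section \<open>Averaging over the trajectory\<close>

lemma prob_space_M: "prob_space M"
  unfolding M_def by (intro prob_space_PiM P.prob_space_axioms)

text \<open>The degenerate case, in which the descent inequality cannot be divided by
  \<open>\<eta>\<close>. The iterates stay at \<open>x1\<close>. Either \<open>gap = 0\<close> and
  \<open>x1\<close> is a minimizer, or all \<open>L i\<close> vanish and the gradient at
  \<open>x1\<close> equals that at \<open>xs\<close>, which is 0.\<close>

lemma step_size_eq_0:
  assumes "\<eta> = 0" and c: "c \<in> idx h k"
  shows "gf (X n \<omega>) c = 0"
proof -
  have X: "X n \<omega> = x1"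
  proof (induction n)
    case 0 show ?case by (rule X_0)
  next
    case (Suc n)
    then show ?case
      using x1 \<open>\<eta> = 0\<close> by (auto simp: fun_eq_iff X_Suc vecs_def idx_def)
  qed
  have "gap = 0 \<or> L1 = 0"
    using assms(1) T \<alpha> by (auto simp: \<eta>_def)
  then show ?thesis
  proof
    assume "gap = 0"
    then show ?thesis unfolding X by (intro gf_minimizer x1 c) (simp add: gap_def)
  next
    assume "L1 = 0"
    obtain i j where ij: "c = (i, j)" "i < h" "j < k" using c by (auto simp: idx_def)
    have "L i = 0"
      using \<open>L1 = 0\<close> ij by (simp add: L1_def sum_nonneg_eq_0_iff)
    then have "bnorm k (\<lambda>c. gf x1 c - gf xs c) i \<le> 0"
      using gf_Lipschitz[OF x1 xs ij(2)] by simp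
    then have "gf x1 c = gf xs c"
      using abs_component_le_bnorm[OF ij(3), of "\<lambda>c. gf x1 c - gf xs c" i] ij by simp
    then show ?thesis using gf_minimizer[OF xs refl c] X by simp
  qed
qed

lemma average_bound:
  fixes a :: "(nat \<times> nat \<Rightarrow> real) \<Rightarrow> nat \<Rightarrow> real"
  assumes a: "\<And>x i. i < h \<Longrightarrow> 0 \<le> a x i"
    and a_bound: "\<And>x i. x \<in> vecs h k \<Longrightarrow> i < h \<Longrightarrow> a x i \<le> B"
    and a_zero: "\<And>x i. i < h \<Longrightarrow> (\<And>c. c \<in> idx h k \<Longrightarrow> gf x c = 0) \<Longrightarrow> a x i = 0"
    and align: "\<And>\<omega> n i. \<omega> \<in> space M \<Longrightarrow> n < T \<Longrightarrow> i < h \<Longrightarrow>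
      a (X n \<omega>) i - 2 * bnorm k (\<lambda>c. g n \<omega> c - gf (X n \<omega>) c) i
      \<le> (\<Sum>j<k. gf (X n \<omega>) (i, j) * R n \<omega> (i, j)) / bnorm k (R n \<omega>) i"
  shows "(\<Sum>n<T. \<integral>\<omega>. (\<Sum>i<h. a (X n \<omega>) i) \<partial>M) / real T
    \<le> \<alpha>u / \<alpha>l * (sqrt (2 * gap * L1 / real T) + 2 * l1norm h k \<sigma> / sqrt (real T))"
    (is "?lhs \<le> ?rhs")
proof (cases "\<eta> = 0")
  case True
  then have "a (X n \<omega>) i = 0" if "i < h" for n \<omega> i
    using that step_size_eq_0 by (intro a_zero) auto
  moreover have "0 \<le> ?rhs"
    using \<alpha> gap_nonneg L1_nonneg by (simp add: l1norm_def sum_nonneg)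
  ultimately show ?thesis by simp
next
  case False
  then have \<eta>: "0 < \<eta>" using \<eta>_nonneg by simp
  interpret M: prob_space M by (rule prob_space_M)
  define A where "A n \<omega> = (\<Sum>i<h. a (X n \<omega>) i)" for n \<omega>
  \<comment> \<open>Only the measurable terms are kept, so that \<open>W\<close> is measurable; as
    all terms are nonnegative, dropping the others preserves the upper bound.\<close>
  define S where "S = {n. n < T \<and> A n \<in> borel_measurable M}"
  define s where "s = l1norm h k \<sigma> / sqrt (real T)"
  have A_nonneg: "0 \<le> A n \<omega>" for n \<omega> unfolding A_def by (intro sum_nonneg a) simp
  have A_le: "A n \<omega> \<le> real h * B" for n \<omega>
    unfolding A_def using a_bound[OF X_vecs] by (intro sum_bounded_above[where K = B, of "{..<h}", simplified]) auto
  have A_int: "integrable M (A n)" if "n \<in> S" for n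
    using that A_le A_nonneg
    by (intro M.integrable_const_bound[where B = "real h * B"]) (auto simp: S_def)
  define W where "W \<omega> = \<alpha>l * \<eta> * (\<Sum>n\<in>S. A n \<omega>)" for \<omega>
  define N where "N t \<omega> = 2 * \<alpha>u * \<eta> * noise t \<omega> (X (t - 1) \<omega>)" for t \<omega>
  have gap_eq: "real T * (\<eta>\<^sup>2 * \<alpha>u\<^sup>2 * L1) = 2 * gap"
  proof -
    have "2 * gap / (\<alpha>u\<^sup>2 * L1 * real T) \<noteq> 0" using \<eta> by (metis \<eta>_def less_irrefl real_sqrt_zero)
    moreover have "\<eta>\<^sup>2 = 2 * gap / (\<alpha>u\<^sup>2 * L1 * real T)"
      using gap_nonneg L1_nonneg by (simp add: \<eta>_def)
    ultimately show ?thesis using T by simp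
  qed
  \<comment> \<open>One \<open>gap\<close> comes from telescoping, the other from the
    \<open>T\<close> quadratic terms, by the choice of \<open>\<eta>\<close>.\<close>
  have path: "W \<omega> \<le> 2 * gap + (\<Sum>t\<in>{1..T}. N t \<omega>)" if \<omega>: "\<omega> \<in> space M" for \<omega>
  proof -
    have "W \<omega> \<le> \<alpha>l * \<eta> * (\<Sum>n<T. A n \<omega>)"
      unfolding W_def using \<alpha> \<eta> A_nonneg by (intro mult_left_mono sum_mono2) (auto simp: S_def)
    also have "\<dots> = (\<Sum>n<T. \<alpha>l * \<eta> * A n \<omega>)" by (rule sum_distrib_left)
    also have "\<dots> \<le> (\<Sum>n<T. (f (X n \<omega>) - f (X (Suc n) \<omega>)) + \<eta>\<^sup>2 * \<alpha>u\<^sup>2 * L1 / 2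
        + 2 * \<alpha>u * \<eta> * noise (Suc n) \<omega> (X n \<omega>))"
      unfolding A_def using align[OF \<omega>] a by (intro sum_mono one_step_decrease) auto
    also have "\<dots> = (f (X 0 \<omega>) - f (X T \<omega>)) + real T * (\<eta>\<^sup>2 * \<alpha>u\<^sup>2 * L1) / 2 + (\<Sum>n<T. N (Suc n) \<omega>)"
      using sum_lessThan_telescope'[of "\<lambda>n. f (X n \<omega>)" T] by (simp add: sum.distrib N_def)
    also have "f (X 0 \<omega>) - f (X T \<omega>) \<le> gap"
      using f_min[OF X_vecs[of T \<omega>]] by (simp add: X_0 gap_def)
    also have "(\<Sum>n<T. N (Suc n) \<omega>) = (\<Sum>t\<in>{1..T}. N t \<omega>)"
      by (simp add: sum.atLeast1_atMost_eq)
    finally show ?thesis by (simp add: gap_eq)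
  qed
  \<comment> \<open>With the past \<open>p\<close> frozen, the iterate is a fixed point of
    \<open>vecs h k\<close> and the noise depends on the new batch only.\<close>
  have N_merge: "N (Suc t) (merge ({1..t} \<times> {..<T}) ({Suc t} \<times> {..<T}) (p, q))
      = 2 * \<alpha>u * \<eta> * noise (Suc t) q (X t p)" for t p q
  proof -
    have "X t (merge ({1..t} \<times> {..<T}) ({Suc t} \<times> {..<T}) (p, q)) = X t p"
      unfolding X_def by (intro arg_cong[where f = fst] lamb_iter_cong) (auto simp: merge_def)
    then show ?thesis
      by (simp add: N_def noise_def batch_grad_def merge_def)
  qed
  have "(\<integral>\<omega>. W \<omega> \<partial>M) \<le> 2 * gap + real T * (2 * \<alpha>u * \<eta> * s)"
    unfolding M_def
  proof (rule integral_le_of_conditional_bounds[where N = N and K = "\<alpha>l * \<eta> * (real T * (real h * \<bar>B\<bar>))"],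
      unfold M_def[symmetric])
    show "prob_space P" by (rule P.prob_space_axioms)
    show "W \<in> borel_measurable M"
      unfolding W_def by (intro borel_measurable_times borel_measurable_const borel_measurable_sum)
        (auto simp: S_def)
    show "W \<omega> \<le> 2 * gap + (\<Sum>t\<in>{1..T}. N t \<omega>)" if "\<omega> \<in> space M" for \<omega>
      by (rule path[OF that])
    show "\<bar>W \<omega>\<bar> \<le> \<alpha>l * \<eta> * (real T * (real h * \<bar>B\<bar>))" for \<omega>
    proof -
      have "(\<Sum>n\<in>S. A n \<omega>) \<le> (\<Sum>n<T. A n \<omega>)"
        using A_nonneg by (intro sum_mono2) (auto simp: S_def)
      also have "\<dots> \<le> (\<Sum>n<T. real h * \<bar>B\<bar>)"
        by (intro sum_mono order_trans[OF A_le] mult_left_mono) auto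
      finally have "(\<Sum>n\<in>S. A n \<omega>) \<le> real T * (real h * \<bar>B\<bar>)" by simp
      moreover have "0 \<le> (\<Sum>n\<in>S. A n \<omega>)" by (intro sum_nonneg A_nonneg)
      ultimately show ?thesis
        using \<alpha> \<eta> by (simp add: W_def abs_mult)
    qed
    show "N t \<omega> = N t \<omega>'"
      if t: "1 \<le> t" and eq: "\<And>u m. 1 \<le> u \<Longrightarrow> u \<le> t \<Longrightarrow> m < T \<Longrightarrow> \<omega> (u, m) = \<omega>' (u, m)" for t \<omega> \<omega>'
    proof -
      have "X (t - 1) \<omega> = X (t - 1) \<omega>'"
        unfolding X_def using eq by (intro arg_cong[where f = fst] lamb_iter_cong) auto
      with t eq show ?thesis by (simp add: N_def noise_def batch_grad_def)
    qed
    show "integrable (PiM ({Suc t} \<times> {..<T}) (\<lambda>_. P))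
        (\<lambda>q. N (Suc t) (merge ({1..t} \<times> {..<T}) ({Suc t} \<times> {..<T}) (p, q)))" for t p
      unfolding N_merge by (intro integrable_mult_right noise_integrable X_vecs)
    show "(\<integral>q. N (Suc t) (merge ({1..t} \<times> {..<T}) ({Suc t} \<times> {..<T}) (p, q))
        \<partial>PiM ({Suc t} \<times> {..<T}) (\<lambda>_. P)) \<le> 2 * \<alpha>u * \<eta> * s" for t p
      unfolding N_merge s_def integral_mult_right_zero
      using \<alpha> \<eta> by (intro mult_left_mono noise_integral_le X_vecs) auto
  qed
  moreover have "(\<integral>\<omega>. W \<omega> \<partial>M) = \<alpha>l * \<eta> * (\<Sum>n<T. \<integral>\<omega>. A n \<omega> \<partial>M)"
  proof -
    have "(\<integral>\<omega>. W \<omega> \<partial>M) = \<alpha>l * \<eta> * (\<Sum>n\<in>S. \<integral>\<omega>. A n \<omega> \<partial>M)"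
      unfolding W_def using A_int by simp
    \<comment> \<open>The terms outside \<open>S\<close> are not integrable and so have integral
      0.\<close>
    also have "(\<Sum>n\<in>S. \<integral>\<omega>. A n \<omega> \<partial>M) = (\<Sum>n<T. \<integral>\<omega>. A n \<omega> \<partial>M)"
      by (intro sum.mono_neutral_left)
         (auto simp: S_def intro!: not_integrable_integral_eq dest: borel_measurable_integrable)
    finally show ?thesis .
  qed
  \<comment> \<open>Rewriting \<open>2 * gap\<close> by \<open>gap_eq\<close> exposes a common
    factor \<open>\<eta>\<close>, which is then cancelled.\<close>
  ultimately have "\<alpha>l * \<eta> * (\<Sum>n<T. \<integral>\<omega>. A n \<omega> \<partial>M) \<le> real T * \<eta> * (\<alpha>u * (\<eta> * \<alpha>u * L1) + 2 * \<alpha>u * s)"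
    using gap_eq by (simp add: algebra_simps power2_eq_square)
  then have "\<eta> * (\<alpha>l * (\<Sum>n<T. \<integral>\<omega>. A n \<omega> \<partial>M)) \<le> \<eta> * (real T * (\<alpha>u * (\<eta> * \<alpha>u * L1 + 2 * s)))"
    by (simp add: algebra_simps)
  then have "\<alpha>l * (\<Sum>n<T. \<integral>\<omega>. A n \<omega> \<partial>M) \<le> real T * (\<alpha>u * (\<eta> * \<alpha>u * L1 + 2 * s))"
    using \<eta> by simp
  then have "(\<Sum>n<T. \<integral>\<omega>. A n \<omega> \<partial>M) / real T \<le> \<alpha>u / \<alpha>l * (\<eta> * \<alpha>u * L1 + 2 * s)"
    using \<alpha> T by (simp add: field_simps)
  also have "\<eta> * \<alpha>u * L1 = sqrt (2 * gap * L1 / real T)"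
  proof (rule real_sqrt_unique[symmetric])
    have "real T * (\<eta> * \<alpha>u * L1)\<^sup>2 = 2 * gap * L1"
      unfolding gap_eq[symmetric] by (simp add: power2_eq_square mult_ac)
    then show "(\<eta> * \<alpha>u * L1)\<^sup>2 = 2 * gap * L1 / real T"
      using T by (simp add: field_simps)
    show "0 \<le> \<eta> * \<alpha>u * L1" using \<eta> \<alpha> L1_nonneg by simp
  qed
  finally show ?thesis by (simp add: A_def s_def)
qed

section \<open>The two convergence rates\<close>

lemma sum_lamb_x:
  "(\<Sum>t\<in>{1..T}. \<integral>\<omega>. F (lamb_x h k gl T \<phi> \<eta> \<beta>2 \<epsilon> x1 \<omega> t) \<partial>M) = (\<Sum>n<T. \<integral>\<omega>. F (X n \<omega>) \<partial>M)"
  by (simp add: lamb_x_def X_def sum.atLeast1_atMost_eq)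

theorem convergence_beta2_zero:
  assumes "\<beta>2 = 0"
  shows "((\<Sum>t\<in>{1..T}. \<integral>\<omega>. l1norm h k (gf (lamb_x h k gl T \<phi> \<eta> \<beta>2 \<epsilon> x1 \<omega> t)) / sqrt (real (h * k)) \<partial>M)
      / real T)\<^sup>2
    \<le> 8 * (\<alpha>u / \<alpha>l)\<^sup>2 * (gap * ((\<Sum>i<h. L i) / real h) / real T
      + (l1norm h k \<sigma>)\<^sup>2 / (real T * real h))"
proof -
  define a where "a x i = (\<Sum>j<k. \<bar>gf x (i, j)\<bar>) / sqrt (real k)" for x i
  define avg where "avg = (\<Sum>n<T. \<integral>\<omega>. (\<Sum>i<h. a (X n \<omega>) i) \<partial>M) / real T"
  define u v where "u = sqrt (2 * gap * L1 / real T)" and "v = 2 * l1norm h k \<sigma> / sqrt (real T)"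
  have "avg \<le> \<alpha>u / \<alpha>l * (u + v)"
    unfolding avg_def u_def v_def
  proof (rule average_bound)
    show "0 \<le> a x i" for x i by (simp add: a_def sum_nonneg)
    show "a x i \<le> real k * G / sqrt (real k)" if "x \<in> vecs h k" "i < h" for x i
      unfolding a_def using gf_bound[OF that(1)] that(2)
      by (intro divide_right_mono sum_bounded_above[where K = G, of "{..<k}", simplified])
         (auto simp: idx_def)
    show "a x i = 0" if "i < h" "\<And>c. c \<in> idx h k \<Longrightarrow> gf x c = 0" for x i
      using that by (simp add: a_def idx_def)
    show "a (X n \<omega>) i - 2 * bnorm k (\<lambda>c. g n \<omega> c - gf (X n \<omega>) c) i
        \<le> (\<Sum>j<k. gf (X n \<omega>) (i, j) * R n \<omega> (i, j)) / bnorm k (R n \<omega>) i" if "i < h" for \<omega> n i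
      unfolding a_def by (rule alignment_beta2_zero[OF assms that])
  qed
  moreover have "0 \<le> avg"
    unfolding avg_def a_def by (intro divide_nonneg_nonneg sum_nonneg Bochner_Integration.integral_nonneg) auto
  ultimately have "avg\<^sup>2 \<le> (\<alpha>u / \<alpha>l * (u + v))\<^sup>2" by (intro power_mono)
  also have "\<dots> = (\<alpha>u / \<alpha>l)\<^sup>2 * (u + v)\<^sup>2" by (rule power_mult_distrib)
  \<comment> \<open>Uses \<open>2 * u * v \<le> u^2 + v^2\<close>. Since \<open>v\<close> already
    contains a factor 2, the variance term gets the coefficient 8, which becomes the overall
    constant.\<close>
  also have "\<dots> \<le> (\<alpha>u / \<alpha>l)\<^sup>2 * (2 * u\<^sup>2 + 2 * v\<^sup>2)"
    using sum_squares_bound[of u v] by (intro mult_left_mono) (auto simp: power2_sum)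
  also have "2 * u\<^sup>2 + 2 * v\<^sup>2 = 4 * gap * L1 / real T + 8 * (l1norm h k \<sigma>)\<^sup>2 / real T"
    using gap_nonneg L1_nonneg by (simp add: u_def v_def power_divide power_mult_distrib)
  also have "\<dots> \<le> 8 * (gap * L1 / real T + (l1norm h k \<sigma>)\<^sup>2 / real T)"
    using gap_nonneg L1_nonneg by (simp add: divide_right_mono)
  finally have main: "avg\<^sup>2 \<le> (\<alpha>u / \<alpha>l)\<^sup>2 * (8 * (gap * L1 / real T + (l1norm h k \<sigma>)\<^sup>2 / real T))"
    by (simp add: mult_left_mono)
  \<comment> \<open>As \<open>d = h * k\<close>, normalizing by \<open>sqrt d\<close> instead of
    \<open>sqrt k\<close> gains \<open>1 / sqrt h\<close>. After squaring this is
    \<open>1 / h\<close>, which turns \<open>L1\<close> into the average of the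
    \<open>L i\<close>.\<close>
  have "l1norm h k (gf x) / sqrt (real (h * k)) = (\<Sum>i<h. a x i) / sqrt (real h)" for x
    by (simp add: l1norm_def sum_idx a_def sum_divide_distrib real_sqrt_mult mult.commute)
  then have "((\<Sum>t\<in>{1..T}. \<integral>\<omega>. l1norm h k (gf (lamb_x h k gl T \<phi> \<eta> \<beta>2 \<epsilon> x1 \<omega> t)) / sqrt (real (h * k)) \<partial>M)
      / real T)\<^sup>2 = (avg / sqrt (real h))\<^sup>2"
    unfolding avg_def sum_lamb_x[of "\<lambda>x. l1norm h k (gf x) / sqrt (real (h * k))"]
    by (simp add: sum_divide_distrib[symmetric] mult.commute)
  also have "\<dots> = avg\<^sup>2 / real h" by (simp add: power_divide)
  also have "\<dots> \<le> (\<alpha>u / \<alpha>l)\<^sup>2 * (8 * (gap * L1 / real T + (l1norm h k \<sigma>)\<^sup>2 / real T)) / real h"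
    by (intro divide_right_mono main) simp
  also have "\<dots> = 8 * (\<alpha>u / \<alpha>l)\<^sup>2 * (gap * ((\<Sum>i<h. L i) / real h) / real T
      + (l1norm h k \<sigma>)\<^sup>2 / (real T * real h))"
    unfolding L1_eq[symmetric] using T h by (simp add: field_simps)
  finally show ?thesis .
qed

theorem convergence_general:
  "(\<Sum>t\<in>{1..T}. \<integral>\<omega>. (l2norm h k (gf (lamb_x h k gl T \<phi> \<eta> \<beta>2 \<epsilon> x1 \<omega> t)))\<^sup>2 \<partial>M) / real T
    \<le> 8 * (\<alpha>u / \<alpha>l)\<^sup>2 * (sqrt (G\<^sup>2 * real (h * k) / (real h * (1 - \<beta>2)))
      * (sqrt (2 * gap * L1 / real T) + l1norm h k \<sigma> / sqrt (real T)))"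
proof -
  define a where "a x i = (bnorm k (gf x) i)\<^sup>2 / (2 * K)" for x i
  define avg where "avg = (\<Sum>n<T. \<integral>\<omega>. (\<Sum>i<h. a (X n \<omega>) i) \<partial>M) / real T"
  define u v where "u = sqrt (2 * gap * L1 / real T)" and "v = l1norm h k \<sigma> / sqrt (real T)"
  have u: "0 \<le> u" and v: "0 \<le> v"
    using gap_nonneg L1_nonneg by (simp_all add: u_def v_def l1norm_def sum_nonneg)
  have avg: "avg \<le> \<alpha>u / \<alpha>l * (u + 2 * v)"
    unfolding avg_def u_def v_def times_divide_eq_right
  proof (rule average_bound)
    show "0 \<le> a x i" for x i using K_nonneg by (simp add: a_def)
    show "a x i \<le> K\<^sup>2 / (2 * K)" if "x \<in> vecs h k" "i < h" for x i
      unfolding a_def using bnorm_gf_le_K[OF that] K_nonneg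
      by (intro divide_right_mono power_mono bnorm_nonneg) auto
    show "a x i = 0" if "i < h" "\<And>c. c \<in> idx h k \<Longrightarrow> gf x c = 0" for x i
      using that by (simp add: a_def idx_def bnorm_def)
    show "a (X n \<omega>) i - 2 * bnorm k (\<lambda>c. g n \<omega> c - gf (X n \<omega>) c) i
        \<le> (\<Sum>j<k. gf (X n \<omega>) (i, j) * R n \<omega> (i, j)) / bnorm k (R n \<omega>) i"
      if "\<omega> \<in> space M" "n < T" "i < h" for \<omega> n i
      unfolding a_def by (rule alignment_general[OF that(1,2) X_vecs that(3)])
  qed
  \<comment> \<open>Undoing the division by \<open>2 * K\<close> is also valid for
    \<open>K = 0\<close>, since \<open>K\<close> bounds the block norm, which is then 0.\<close>
  have block: "(bnorm k (gf (X n \<omega>)) i)\<^sup>2 = 2 * K * a (X n \<omega>) i" if "i < h" for n \<omega> i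
    using bnorm_gf_le_K[OF X_vecs[of n \<omega>] that] bnorm_nonneg[of k "gf (X n \<omega>)" i]
    by (cases "K = 0") (auto simp: a_def)
  have "(l2norm h k (gf (X n \<omega>)))\<^sup>2 = 2 * K * (\<Sum>i<h. a (X n \<omega>) i)" for n \<omega>
  proof -
    have "(l2norm h k (gf (X n \<omega>)))\<^sup>2 = (\<Sum>i<h. (bnorm k (gf (X n \<omega>)) i)\<^sup>2)"
      by (simp add: l2norm_def bnorm_power2 sum_idx sum_nonneg)
    then show ?thesis using block by (simp add: sum_distrib_left)
  qed
  then have "(\<Sum>t\<in>{1..T}. \<integral>\<omega>. (l2norm h k (gf (lamb_x h k gl T \<phi> \<eta> \<beta>2 \<epsilon> x1 \<omega> t)))\<^sup>2 \<partial>M) / real T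
      = 2 * K * avg"
    unfolding avg_def sum_lamb_x[of "\<lambda>x. (l2norm h k (gf x))\<^sup>2"]
    by (simp add: sum_distrib_left[symmetric])
  also have "\<dots> \<le> 2 * K * (\<alpha>u / \<alpha>l * (u + 2 * v))"
    using K_nonneg by (intro mult_left_mono avg) simp
  \<comment> \<open>A deliberate weakening, using \<open>\<alpha>u / \<alpha>l \<ge> 1\<close>, so
    that the same constant \<open>8 * (\<alpha>u / \<alpha>l)^2\<close> serves both rates.\<close>
  also have "\<dots> \<le> 2 * K * ((\<alpha>u / \<alpha>l)\<^sup>2 * (4 * (u + v)))"
  proof -
    have one: "1 \<le> \<alpha>u / \<alpha>l" using \<alpha> by simp
    then have "\<alpha>u / \<alpha>l \<le> (\<alpha>u / \<alpha>l)\<^sup>2"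
      by (rule self_le_power) simp
    then show ?thesis using K_nonneg u v by (intro mult_left_mono mult_mono) auto
  qed
  also have "K = sqrt (G\<^sup>2 * real (h * k) / (real h * (1 - \<beta>2)))"
    using h G_nonneg by (simp add: K_def real_sqrt_mult real_sqrt_divide)
  also have "2 * sqrt (G\<^sup>2 * real (h * k) / (real h * (1 - \<beta>2))) * ((\<alpha>u / \<alpha>l)\<^sup>2 * (4 * (u + v)))
      = 8 * (\<alpha>u / \<alpha>l)\<^sup>2 * (sqrt (G\<^sup>2 * real (h * k) / (real h * (1 - \<beta>2))) * (u + v))"
    by algebra
  finally show ?thesis by (simp only: u_def v_def)
qed

end

theorem theorem3:
  fixes \<alpha>l \<alpha>u :: real
  assumes "0 < \<alpha>l" and "\<alpha>l \<le> \<alpha>u"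
  shows "\<exists>C::real. \<forall>(h::nat) (k::nat) (T::nat) (P::'s measure)
      (lf :: (nat \<times> nat \<Rightarrow> real) \<Rightarrow> 's \<Rightarrow> real)
      (gl :: (nat \<times> nat \<Rightarrow> real) \<Rightarrow> 's \<Rightarrow> nat \<times> nat \<Rightarrow> real)
      (f :: (nat \<times> nat \<Rightarrow> real) \<Rightarrow> real)
      (gf :: (nat \<times> nat \<Rightarrow> real) \<Rightarrow> nat \<times> nat \<Rightarrow> real)
      (L :: nat \<Rightarrow> real) (\<sigma> :: nat \<times> nat \<Rightarrow> real) (G::real)
      (\<beta>2::real) (\<epsilon>::real) (\<phi> :: real \<Rightarrow> real) x1 xs.
    1 \<le> h \<and> 1 \<le> k \<and> 1 \<le> T \<and> prob_space P
    \<and> x1 \<in> vecs h k \<and> xs \<in> vecs h k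
    \<and> (\<forall>x\<in>vecs h k. integrable P (lf x) \<and> f x = (\<integral>s. lf x s \<partial>P))
    \<and> (\<forall>x\<in>vecs h k. \<forall>s\<in>space P. \<forall>c\<in>idx h k.
          ((\<lambda>u. lf (x(c := u)) s) has_real_derivative gl x s c) (at (x c)))
    \<and> (\<forall>x\<in>vecs h k. \<forall>c\<in>idx h k.
          ((\<lambda>u. f (x(c := u))) has_real_derivative gf x c) (at (x c)))
    \<and> (\<forall>x\<in>vecs h k. \<forall>c\<in>idx h k. (\<lambda>s. gl x s c) \<in> borel_measurable P)
    \<and> (\<forall>x\<in>vecs h k. f xs \<le> f x)
    \<and> (\<forall>x\<in>vecs h k. \<forall>y\<in>vecs h k. \<forall>s\<in>space P. \<forall>i<h.
          bnorm k (\<lambda>c. gl x s c - gl y s c) i \<le> L i * bnorm k (\<lambda>c. x c - y c) i)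
    \<and> (\<forall>x\<in>vecs h k. \<forall>c\<in>idx h k. (\<integral>s. (gl x s c - gf x c)^2 \<partial>P) \<le> (\<sigma> c)^2)
    \<and> (\<forall>x\<in>vecs h k. \<forall>s\<in>space P. \<forall>c\<in>idx h k. \<bar>gl x s c\<bar> \<le> G)
    \<and> 0 \<le> \<beta>2 \<and> \<beta>2 < 1 \<and> 0 < \<epsilon>
    \<and> (\<forall>v\<ge>0. \<alpha>l \<le> \<phi> v \<and> \<phi> v \<le> \<alpha>u)
    \<longrightarrow>
    (let M = PiM ({1..T} \<times> {..<T}) (\<lambda>_. P);
         \<eta> = sqrt (2 * (f x1 - f xs) / (\<alpha>u^2 * (\<Sum>i<h. \<bar>L i\<bar>) * real T));
         X = (\<lambda>\<omega> t. lamb_x h k gl T \<phi> \<eta> \<beta>2 \<epsilon> x1 \<omega> t);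
         d = real (h * k);
         Lavg = (\<Sum>i<h. L i) / real h;
         L1 = (\<Sum>i<h. \<bar>L i\<bar>);
         \<sigma>1 = l1norm h k \<sigma>
     in (\<beta>2 = 0 \<longrightarrow>
           ((\<Sum>t\<in>{1..T}. (\<integral>\<omega>. l1norm h k (gf (X \<omega> t)) / sqrt d \<partial>M)) / real T)^2
           \<le> C * ((f x1 - f xs) * Lavg / real T + \<sigma>1^2 / (real T * real h)))
      \<and> (0 < \<beta>2 \<longrightarrow>
           (\<Sum>t\<in>{1..T}. (\<integral>\<omega>. (l2norm h k (gf (X \<omega> t)))^2 \<partial>M)) / real T
           \<le> C * (sqrt (G^2 * d / (real h * (1 - \<beta>2)))
                  * (sqrt (2 * (f x1 - f xs) * L1 / real T) + \<sigma>1 / sqrt (real T)))))"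
proof (intro exI[of _ "8 * (\<alpha>u / \<alpha>l)\<^sup>2"] allI impI, elim conjE)
  fix h k T :: nat and P :: "'s measure" and lf :: "(nat \<times> nat \<Rightarrow> real) \<Rightarrow> 's \<Rightarrow> real"
    and gl :: "(nat \<times> nat \<Rightarrow> real) \<Rightarrow> 's \<Rightarrow> nat \<times> nat \<Rightarrow> real"
    and f :: "(nat \<times> nat \<Rightarrow> real) \<Rightarrow> real"
    and gf :: "(nat \<times> nat \<Rightarrow> real) \<Rightarrow> nat \<times> nat \<Rightarrow> real"
    and L :: "nat \<Rightarrow> real" and \<sigma> :: "nat \<times> nat \<Rightarrow> real" and G \<beta>2 \<epsilon> :: real
    and \<phi> :: "real \<Rightarrow> real" and x1 xs :: "nat \<times> nat \<Rightarrow> real"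
  assume prems:
    "1 \<le> h" "1 \<le> k" "1 \<le> T" "prob_space P" "x1 \<in> vecs h k" "xs \<in> vecs h k"
    "\<forall>x\<in>vecs h k. integrable P (lf x) \<and> f x = (\<integral>s. lf x s \<partial>P)"
    "\<forall>x\<in>vecs h k. \<forall>s\<in>space P. \<forall>c\<in>idx h k.
      ((\<lambda>u. lf (x(c := u)) s) has_real_derivative gl x s c) (at (x c))"
    "\<forall>x\<in>vecs h k. \<forall>c\<in>idx h k. ((\<lambda>u. f (x(c := u))) has_real_derivative gf x c) (at (x c))"
    "\<forall>x\<in>vecs h k. \<forall>c\<in>idx h k. (\<lambda>s. gl x s c) \<in> borel_measurable P"
    "\<forall>x\<in>vecs h k. f xs \<le> f x"
    "\<forall>x\<in>vecs h k. \<forall>y\<in>vecs h k. \<forall>s\<in>space P. \<forall>i<h.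
      bnorm k (\<lambda>c. gl x s c - gl y s c) i \<le> L i * bnorm k (\<lambda>c. x c - y c) i"
    "\<forall>x\<in>vecs h k. \<forall>c\<in>idx h k. (\<integral>s. (gl x s c - gf x c)^2 \<partial>P) \<le> (\<sigma> c)^2"
    "\<forall>x\<in>vecs h k. \<forall>s\<in>space P. \<forall>c\<in>idx h k. \<bar>gl x s c\<bar> \<le> G"
    "0 \<le> \<beta>2" "\<beta>2 < 1" "0 < \<epsilon>" "\<forall>v\<ge>0. \<alpha>l \<le> \<phi> v \<and> \<phi> v \<le> \<alpha>u"
  interpret lamb_problem P h k T lf gl f gf L \<sigma> G \<beta>2 \<epsilon> \<phi> \<alpha>l \<alpha>u x1 xs
    unfolding lamb_problem_def lamb_problem_axioms_def using prems assms by auto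
  show "let M = PiM ({1..T} \<times> {..<T}) (\<lambda>_. P);
         \<eta> = sqrt (2 * (f x1 - f xs) / (\<alpha>u^2 * (\<Sum>i<h. \<bar>L i\<bar>) * real T));
         X = (\<lambda>\<omega> t. lamb_x h k gl T \<phi> \<eta> \<beta>2 \<epsilon> x1 \<omega> t);
         d = real (h * k);
         Lavg = (\<Sum>i<h. L i) / real h;
         L1 = (\<Sum>i<h. \<bar>L i\<bar>);
         \<sigma>1 = l1norm h k \<sigma>
     in (\<beta>2 = 0 \<longrightarrow>
           ((\<Sum>t\<in>{1..T}. (\<integral>\<omega>. l1norm h k (gf (X \<omega> t)) / sqrt d \<partial>M)) / real T)^2
           \<le> 8 * (\<alpha>u / \<alpha>l)\<^sup>2 * ((f x1 - f xs) * Lavg / real T + \<sigma>1^2 / (real T * real h)))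
      \<and> (0 < \<beta>2 \<longrightarrow>
           (\<Sum>t\<in>{1..T}. (\<integral>\<omega>. (l2norm h k (gf (X \<omega> t)))^2 \<partial>M)) / real T
           \<le> 8 * (\<alpha>u / \<alpha>l)\<^sup>2 * (sqrt (G^2 * d / (real h * (1 - \<beta>2)))
                  * (sqrt (2 * (f x1 - f xs) * L1 / real T) + \<sigma>1 / sqrt (real T))))"
    using convergence_beta2_zero convergence_general
    unfolding Let_def M_def \<eta>_def gap_def L1_def by blast
qed

end
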